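(* Let $\alpha,\beta,\gamma,\delta\in\mathbb{C}$ with $\mathrm{Re}(\alpha)>0$ and $\mathrm{Re}(\beta)>0$. Then the bivariate Mittag-Leffler function has the complex integral representation $$E_{\alpha,\beta,\gamma}^{\delta}(x,y)=\frac{1}{2\pi i}\int_H\frac{e^tt^{-\gamma}}{(1-xt^{-\alpha}-yt^{-\beta})^{\delta}}\,\mathrm{d}t,$$ where $H$ is the Hankel contour in the complex plane, which starts and ends at $-\infty$ and wraps around the origin in a positive direction, and where all fractional powers of $t$ are defined using the principal branch with branch cut $(-\infty,0]$.
   Context: For $\alpha,\beta,\gamma,\delta\in\mathbb{C}$ with $\mathrm{Re}(\alpha)>0$, $\mathrm{Re}(\beta)>0$ and $x,y\in\mathbb{C}$, the bivariate Mittag-Leffler function is $$E_{\alpha,\beta,\gamma}^{\delta}(x,y)=\sum_{k=0}^{\infty}\sum_{l=0}^{\infty}\frac{(\delta)_{k+l}}{\Gamma(\alpha k+\beta l+\gamma)}\cdot\frac{x^ky^l}{k!\,l!}$$ (the double series converges absolutely and locally uniformly), where $(a)_n=a(a+1)\cdots(a+n-1)$, $(a)_0=1$, is the Pochhammer symbol.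
   Formalization: The Hankel contour H is required to satisfy |x t^{-α} + y t^{-β}| < 1 at all its points (true for every H far enough from the origin); for an H tight around the cut the formula can fail, e.g. α=δ=1, γ=y=0, x=5. *)

theory Defs
  imports "HOL-Complex_Analysis.Complex_Analysis"
begin

text \<open>
  The entire function \<open>rGamma\<close> is the reciprocal of the Gamma function; it vanishes at the poles
  of the Gamma function.
\<close>

definition bivariate_mittag_leffler ::
    "complex \<Rightarrow> complex \<Rightarrow> complex \<Rightarrow> complex \<Rightarrow> complex \<Rightarrow> complex \<Rightarrow> complex" where
  "bivariate_mittag_leffler \<alpha> \<beta> \<gamma> \<delta> x y =
     (\<Sum>k. \<Sum>l. pochhammer \<delta> (k + l) * rGamma (\<alpha> * of_nat k + \<beta> * of_nat l + \<gamma>)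
               * (x ^ k * y ^ l / (fact k * fact l)))"

text \<open>
  A Hankel contour is represented by its finite middle part \<open>g\<close>.  The full contour comes in from
  \<open>-\<infinity>\<close> along the horizontal ray ending at \<open>pathstart g\<close>, which lies below the branch cut,
  follows \<open>g\<close> inside the slit plane, and returns to \<open>-\<infinity>\<close> along the horizontal ray starting at
  \<open>pathfinish g\<close>, which lies above the branch cut.  A contour of this kind avoids the cut
  \<open>(-\<infinity>, 0]\<close> and leads from its lower to its upper side, so the argument increases from \<open>-\<pi>\<close>
  to \<open>\<pi>\<close> along it: it wraps around the origin in the positive direction.
\<close>

definition hankel_contour :: "(real \<Rightarrow> complex) \<Rightarrow> bool" where
  "hankel_contour g \<longleftrightarrow>
     valid_path g \<and> path_image g \<inter> \<real>\<^sub>\<le>\<^sub>0 = {} \<and> Im (pathstart g) < 0 \<and> Im (pathfinish g) > 0"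

definition left_ray :: "complex \<Rightarrow> complex set" where
  "left_ray p = {t. Re t \<le> Re p \<and> Im t = Im p}"

definition hankel_image :: "(real \<Rightarrow> complex) \<Rightarrow> complex set" where
  "hankel_image g = left_ray (pathstart g) \<union> path_image g \<union> left_ray (pathfinish g)"

definition hankel_integrable :: "(complex \<Rightarrow> complex) \<Rightarrow> (real \<Rightarrow> complex) \<Rightarrow> bool" where
  "hankel_integrable f g \<longleftrightarrow>
     set_integrable lborel {..Re (pathstart g)} (\<lambda>s. f (Complex s (Im (pathstart g)))) \<and>
     f contour_integrable_on g \<and>
     set_integrable lborel {..Re (pathfinish g)} (\<lambda>s. f (Complex s (Im (pathfinish g))))"

text \<open>The upper ray is traversed from right to left, hence the minus sign.\<close>

definition hankel_integral :: "(complex \<Rightarrow> complex) \<Rightarrow> (real \<Rightarrow> complex) \<Rightarrow> complex" where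
  "hankel_integral f g =
     (LBINT s:{..Re (pathstart g)}. f (Complex s (Im (pathstart g))))
     + contour_integral g f
     - (LBINT s:{..Re (pathfinish g)}. f (Complex s (Im (pathfinish g))))"

text \<open>
  With principal powers, the integrand of the representation is meaningful only on contours that
  stay outside the region containing the zeros of \<open>1 - x t\<^sup>-\<^sup>\<alpha> - y t\<^sup>-\<^sup>\<beta>\<close> and the
  branch cuts issuing from them.  The condition below keeps the base of the outer power in the unit
  disc about 1; the two lemmas show that every Hankel contour sufficiently far from the origin
  satisfies it, and that such contours exist.
\<close>

definition hankel_admissible ::
    "complex \<Rightarrow> complex \<Rightarrow> complex \<Rightarrow> complex \<Rightarrow> (real \<Rightarrow> complex) \<Rightarrow> bool" where
  "hankel_admissible \<alpha> \<beta> x y g \<longleftrightarrow>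
     (\<forall>t \<in> hankel_image g. norm (x * t powr (-\<alpha>) + y * t powr (-\<beta>)) < 1)"

lemma norm_powr_neg_small:
  fixes \<alpha> x :: complex
  assumes "Re \<alpha> > 0" and "e > 0"
  shows "\<exists>R>0. \<forall>t. norm t \<ge> R \<longrightarrow> norm (x * t powr (-\<alpha>)) < e"
proof -
  define C where "C = norm x * exp (\<bar>Im \<alpha>\<bar> * pi)"
  have "((\<lambda>r::real. C * r powr (- Re \<alpha>)) \<longlongrightarrow> C * 0) at_top"
    by (intro tendsto_mult tendsto_const tendsto_neg_powr filterlim_ident) (use assms in auto)
  then have "eventually (\<lambda>r. C * r powr (- Re \<alpha>) < e) at_top"
    using assms(2) by (auto simp: order_tendsto_iff)
  then obtain R0 where R0: "\<And>r. r \<ge> R0 \<Longrightarrow> C * r powr (- Re \<alpha>) < e"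
    by (auto simp: eventually_at_top_linorder)
  show ?thesis
  proof (intro exI[of _ "max 1 R0"] conjI allI impI)
    fix t :: complex assume t: "max 1 R0 \<le> norm t"
    then have "t \<noteq> 0" by auto
    have "\<bar>Im \<alpha> * Im (Ln t)\<bar> \<le> \<bar>Im \<alpha>\<bar> * pi"
      unfolding abs_mult
      using mpi_less_Im_Ln[OF \<open>t \<noteq> 0\<close>] Im_Ln_le_pi[OF \<open>t \<noteq> 0\<close>]
      by (intro mult_left_mono) auto
    then have "norm (t powr (-\<alpha>)) \<le> exp (\<bar>Im \<alpha>\<bar> * pi) * norm t powr (- Re \<alpha>)"
      using \<open>t \<noteq> 0\<close> by (auto simp: powr_def mult_exp_exp)
    then have "norm (x * t powr (-\<alpha>)) \<le> C * norm t powr (- Re \<alpha>)"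
      by (simp add: C_def norm_mult mult.assoc mult_left_mono)
    also have "\<dots> < e" using R0 t by auto
    finally show "norm (x * t powr (-\<alpha>)) < e" .
  qed auto
qed

lemma hankel_admissible_if_far:
  fixes \<alpha> \<beta> x y :: complex
  assumes "Re \<alpha> > 0" and "Re \<beta> > 0"
  shows "\<exists>R. \<forall>g. (\<forall>t \<in> hankel_image g. norm t \<ge> R) \<longrightarrow> hankel_admissible \<alpha> \<beta> x y g"
proof -
  obtain R1 where R1: "\<And>t. norm t \<ge> R1 \<Longrightarrow> norm (x * t powr (-\<alpha>)) < 1/2"
    using norm_powr_neg_small[OF assms(1), of "1/2" x] by auto
  obtain R2 where R2: "\<And>t. norm t \<ge> R2 \<Longrightarrow> norm (y * t powr (-\<beta>)) < 1/2"
    using norm_powr_neg_small[OF assms(2), of "1/2" y] by auto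
  have "norm (x * t powr (-\<alpha>) + y * t powr (-\<beta>)) < 1" if "norm t \<ge> max R1 R2" for t
    using norm_triangle_ineq[of "x * t powr (-\<alpha>)" "y * t powr (-\<beta>)"] R1[of t] R2[of t] that
    by auto
  then show ?thesis
    unfolding hankel_admissible_def by blast
qed

lemma ex_hankel_contour_far:
  "\<exists>g. hankel_contour g \<and> (\<forall>t \<in> hankel_image g. norm t \<ge> R)"
proof -
  define r where "r = max 1 R"
  define g where "g = linepath (Complex r (- r)) (Complex r r)"
  have r: "r \<ge> 1" "r \<ge> R" by (auto simp: r_def)
  have re: "Re t = r" if "t \<in> path_image g" for t
  proof -
    from that obtain u where "t = (1 - u) *\<^sub>R Complex r (- r) + u *\<^sub>R Complex r r"
      by (auto simp: g_def closed_segment_def)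
    then have "Re t = (1 - u) * r + u * r" by simp
    then show ?thesis by (simp add: algebra_simps)
  qed
  have "hankel_contour g"
    using re r by (force simp: hankel_contour_def g_def complex_nonpos_Reals_iff)
  moreover have "norm t \<ge> R" if "t \<in> hankel_image g" for t
  proof -
    have "\<bar>Re t\<bar> \<ge> r \<or> \<bar>Im t\<bar> \<ge> r"
      using that re[of t] by (auto simp: hankel_image_def left_ray_def g_def)
    then show ?thesis
      using abs_Re_le_cmod[of t] abs_Im_le_cmod[of t] r by linarith
  qed
  ultimately show ?thesis by blast
qed

end

theory Submission
  imports Defs
begin

text \<open>
  Put \<open>h t = x * t powr (-\<alpha>) + y * t powr (-\<beta>)\<close>, so that the integrand is
  \<open>exp t * t powr (-\<gamma>) * (1 - h t) powr (-\<delta>)\<close>.  The idea is to expand the last factor into its binomial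
  series in \<open>h\<close>, to expand each power of \<open>h\<close> by the finite binomial theorem, and to evaluate the resulting
  integrals of \<open>exp t * t powr (- s)\<close> with \<open>s = \<alpha> k + \<beta> l + \<gamma>\<close> by Hankel's formula
  (\<open>hankel_integral_rGamma\<close>).

  Admissibility bounds \<open>h\<close> but not the sum of the norms of its two summands, so on the given contour
  only the series in powers of \<open>h\<close> is sure to converge; the double expansion in \<open>k\<close> and \<open>l\<close> may diverge.  The norm of \<open>h\<close> is
  bounded by a constant below 1 on the whole contour (\<open>hankel_admissible_uniform\<close>), which makes the
  series in \<open>h\<close> uniformly convergent and integrable term by term (\<open>hankel_integral_neg_binomial\<close>).  The
  outcome is the double series summed along the diagonals \<open>k + l = n\<close>.

  To return to iterated summation, absolute convergence of the double series is needed.  The required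
  estimate of the reciprocal Gamma function comes from Hankel's formula again, now on a contour far from the
  origin (\<open>rGamma_lattice_bound\<close>).

  Hankel's formula is proved with primitives instead of deformations of the contour: if \<open>F\<close> is a primitive
  of the integrand on the slit plane, the integral is the limit of the difference of \<open>F\<close> between the upper
  and the lower ray (\<open>hankel_integral_eq_limit\<close>).  For \<open>Re s < 1\<close> the primitive is an incomplete Gamma
  function, whose two boundary values differ by phase factors, and the reflection formula gives the value;
  integration by parts and a separate computation at \<open>s = 1\<close> give the remaining \<open>s\<close>.
\<close>

section \<open>The slit plane\<close>

abbreviation slit_plane :: "complex set" where
  "slit_plane \<equiv> - \<real>\<^sub>\<le>\<^sub>0"

lemma open_slit_plane: "open slit_plane"
  by (simp add: open_Compl)

lemma Complex_in_slit_plane: "b \<noteq> 0 \<Longrightarrow> Complex u b \<in> slit_plane"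
  by (simp add: complex_nonpos_Reals_iff)

section \<open>Bounds for Hankel integrals\<close>

lemma holomorphic_on_kernel: "(\<lambda>t. exp t * t powr s) holomorphic_on slit_plane"
  by (auto intro!: holomorphic_intros)

text \<open>
  Off a disc around the origin a power of \<open>t\<close> grows at most polynomially, and its argument part is
  bounded because the principal argument is.  The rate \<open>1/2\<close> in the exponent leaves half of the decay
  of \<open>exp t\<close> on a left ray to spare.
\<close>

lemma norm_powr_le_exp:
  fixes s :: complex
  assumes "\<rho> > 0"
  shows "\<exists>C>0. \<forall>t. norm t \<ge> \<rho> \<longrightarrow> norm (t powr s) \<le> C * exp (norm t / 2)"
proof -
  define k where "k = nat \<lceil>\<bar>Re s\<bar>\<rceil>"
  define C where "C = exp (\<bar>Im s\<bar> * pi) * (\<rho> powr Re s * ((2 / \<rho>) ^ k * fact k))"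
  have "norm (t powr s) \<le> C * exp (norm t / 2)" if t: "norm t \<ge> \<rho>" for t
  proof -
    have "t \<noteq> 0" using t assms by auto
    have "\<bar>Im s * Im (Ln t)\<bar> \<le> \<bar>Im s\<bar> * pi"
      unfolding abs_mult
      using mpi_less_Im_Ln[OF \<open>t \<noteq> 0\<close>] Im_Ln_le_pi[OF \<open>t \<noteq> 0\<close>]
      by (intro mult_left_mono) auto
    then have 1: "norm (t powr s) \<le> exp (\<bar>Im s\<bar> * pi) * norm t powr Re s"
      using \<open>t \<noteq> 0\<close> by (auto simp: powr_def mult_exp_exp)
    \<comment> \<open>Rescaling by \<open>\<rho>\<close> makes the base at least 1, so that the exponent may be rounded up.\<close>
    have "(norm t / \<rho>) powr Re s \<le> (norm t / \<rho>) powr real k"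
    proof (rule powr_mono)
      show "Re s \<le> real k" unfolding k_def by linarith
    qed (use t assms in simp)
    also have "\<dots> = (2 / \<rho>) ^ k * (norm t / 2) ^ k"
      using t assms \<open>t \<noteq> 0\<close> by (simp add: powr_realpow power_divide power_mult_distrib)
    also have "\<dots> \<le> (2 / \<rho>) ^ k * (fact k * exp (norm t / 2))"
    proof (intro mult_left_mono)
      \<comment> \<open>A single term of the exponential series is at most its sum.\<close>
      have "(\<Sum>n\<in>{k}. (norm t / 2) ^ n /\<^sub>R fact n) \<le> exp (norm t / 2)"
        unfolding exp_def using summable_exp_generic[of "norm t / 2"]
        by (intro sum_le_suminf) auto
      then show "(norm t / 2) ^ k \<le> fact k * exp (norm t / 2)"
        by (simp add: field_simps)
    qed (use assms in auto)
    finally have 2: "(norm t / \<rho>) powr Re s \<le> (2 / \<rho>) ^ k * fact k * exp (norm t / 2)"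
      by (simp add: mult.assoc)
    have "norm t powr Re s = \<rho> powr Re s * (norm t / \<rho>) powr Re s"
      using assms by (simp add: powr_divide)
    also have "\<dots> \<le> \<rho> powr Re s * ((2 / \<rho>) ^ k * fact k * exp (norm t / 2))"
      by (intro mult_left_mono 2) auto
    finally have "exp (\<bar>Im s\<bar> * pi) * norm t powr Re s
        \<le> exp (\<bar>Im s\<bar> * pi) * (\<rho> powr Re s * ((2 / \<rho>) ^ k * fact k * exp (norm t / 2)))"
      by (intro mult_left_mono) auto
    also have "\<dots> = C * exp (norm t / 2)" by (simp add: C_def)
    finally show ?thesis using 1 by linarith
  qed
  moreover have "C > 0" using assms by (auto simp: C_def)
  ultimately show ?thesis by blast
qed

lemma norm_kernel_le_exp_Re:
  fixes s :: complex
  assumes "\<rho> > 0"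
  shows "\<exists>C>0. \<forall>t. norm t \<ge> \<rho> \<longrightarrow> Re t \<le> a \<longrightarrow> \<bar>Im t\<bar> \<le> b \<longrightarrow>
           norm (exp t * t powr s) \<le> C * exp (Re t / 2)"
proof -
  obtain C where C: "C > 0" "\<And>t. norm t \<ge> \<rho> \<Longrightarrow> norm (t powr s) \<le> C * exp (norm t / 2)"
    using norm_powr_le_exp[OF assms, of s] by blast
  have "norm (exp t * t powr s) \<le> (C * exp (\<bar>a\<bar> + b / 2)) * exp (Re t / 2)"
    if t: "norm t \<ge> \<rho>" "Re t \<le> a" "\<bar>Im t\<bar> \<le> b" for t
  proof -
    have "norm (exp t * t powr s) \<le> exp (Re t) * (C * exp (norm t / 2))"
      unfolding norm_mult norm_exp_eq_Re using C(2)[OF t(1)] by (intro mult_left_mono) auto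
    also have "\<dots> = C * exp (Re t + norm t / 2)"
      by (simp add: exp_add)
    also have "\<dots> \<le> C * exp ((\<bar>a\<bar> + b / 2) + Re t / 2)"
      using C t cmod_le[of t] by (auto intro!: mult_left_mono)
    also have "\<dots> = (C * exp (\<bar>a\<bar> + b / 2)) * exp (Re t / 2)"
      by (simp only: exp_add mult.assoc)
    finally show ?thesis .
  qed
  moreover have "C * exp (\<bar>a\<bar> + b / 2) > 0" using C by auto
  ultimately show ?thesis by blast
qed

lemma set_integrable_exp_half_atMost: "set_integrable lborel {..a} (\<lambda>u::real. exp (u / 2))"
proof -
  have "(\<integral>\<^sup>+x. ennreal (exp (- (x / 2))) * indicator {-a..} x \<partial>lborel)
      = ennreal (0 - (- 2 * exp (- ((-a) / 2))))"
  proof (rule nn_integral_FTC_atLeast[where F="\<lambda>x. -2 * exp (- (x / 2))"])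
    show "((\<lambda>x. - 2 * exp (- (x / 2))) \<longlongrightarrow> 0) (at_top :: real filter)"
      by real_asymp
  qed (auto intro!: derivative_eq_intros)
  moreover have "(\<integral>\<^sup>+x. ennreal (indicator {-a..} x *\<^sub>R exp (- (x / 2))) \<partial>lborel)
      = (\<integral>\<^sup>+x. ennreal (exp (- (x / 2))) * indicator {-a..} x \<partial>lborel)"
    by (intro nn_integral_cong) (auto simp: indicator_def)
  ultimately have "(\<integral>\<^sup>+x. ennreal (indicator {-a..} x *\<^sub>R exp (- (x / 2))) \<partial>lborel) < \<infinity>"
    by (simp only: ennreal_less_top infinity_ennreal_def)
  then have "integrable lborel (\<lambda>x. indicator {-a..} x *\<^sub>R exp (- (x / 2)))"
    by (intro integrableI_nonneg) auto
  from lborel_integrable_real_affine[OF this, of "-1" 0]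
  have "integrable lborel (\<lambda>x. indicat_real {-a..} (- x) *\<^sub>R exp (x / 2))" by simp
  also have "(\<lambda>x. indicat_real {-a..} (- x) *\<^sub>R exp (x / 2)) = (\<lambda>x. indicat_real {..a} x *\<^sub>R exp (x / 2))"
    by (auto simp: fun_eq_iff indicator_def)
  finally show ?thesis by (simp add: set_integrable_def)
qed

text \<open>
  The integral along a ray is bounded by the supremum of the factor \<open>q\<close>, with a constant
  independent of \<open>q\<close>.  This uniformity is what later allows limits under the integral sign.
\<close>

lemma ray_integral_bound:
  fixes s :: complex
  assumes "b \<noteq> 0" and "open V" and "\<And>u. u \<le> a \<Longrightarrow> Complex u b \<in> V"
  obtains L where "L > 0" and "\<And>q B. q holomorphic_on V \<Longrightarrow> (\<And>t. t \<in> V \<Longrightarrow> norm (q t) \<le> B) \<Longrightarrow>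
      set_integrable lborel {..a} (\<lambda>u. exp (Complex u b) * Complex u b powr s * q (Complex u b)) \<and>
      norm (LBINT u:{..a}. exp (Complex u b) * Complex u b powr s * q (Complex u b)) \<le> L * B"
proof -
  obtain C where C: "C > 0" "\<And>t. norm t \<ge> \<bar>b\<bar> \<Longrightarrow> Re t \<le> a \<Longrightarrow> \<bar>Im t\<bar> \<le> \<bar>b\<bar> \<Longrightarrow>
           norm (exp t * t powr s) \<le> C * exp (Re t / 2)"
    using norm_kernel_le_exp_Re[of "\<bar>b\<bar>" a "\<bar>b\<bar>" s] assms by auto
  define J where "J = (LBINT u:{..a}. exp (u / 2))"
  have "J \<ge> 0" unfolding J_def set_lebesgue_integral_def
    by (intro integral_nonneg_AE) auto
  have "set_integrable lborel {..a} (\<lambda>u. exp (Complex u b) * Complex u b powr s * q (Complex u b)) \<and>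
      norm (LBINT u:{..a}. exp (Complex u b) * Complex u b powr s * q (Complex u b)) \<le> (C * J + 1) * B"
    if q: "q holomorphic_on V" and B: "\<And>t. t \<in> V \<Longrightarrow> norm (q t) \<le> B" for q B
  proof -
    let ?h = "\<lambda>u. exp (Complex u b) * Complex u b powr s * q (Complex u b)"
    have "B \<ge> 0" using B[OF assms(3)[of a]] norm_ge_zero[of "q (Complex a b)"] by linarith
    have le: "norm (?h u) \<le> C * B * exp (u / 2)" if "u \<le> a" for u
    proof -
      have "norm (exp (Complex u b) * Complex u b powr s) \<le> C * exp (u / 2)"
        using C(2)[of "Complex u b"] that abs_Im_le_cmod[of "Complex u b"] by simp
      then have "norm (?h u) \<le> (C * exp (u / 2)) * B"
        unfolding norm_mult[of _ "q (Complex u b)"]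
        using B[OF assms(3)[OF that]] C(1) by (intro mult_mono) auto
      then show ?thesis by (simp add: mult_ac)
    qed
    have ray: "continuous_on {..a} (\<lambda>u. Complex u b)"
      by (auto simp: Complex_eq intro!: continuous_intros)
    have cont: "continuous_on {..a} ?h"
    proof (rule continuous_on_mult)
      show "continuous_on {..a} (\<lambda>u. exp (Complex u b) * Complex u b powr s)"
        by (rule continuous_on_compose2[OF holomorphic_on_imp_continuous_on[OF holomorphic_on_kernel] ray])
          (use Complex_in_slit_plane[OF assms(1)] in auto)
      show "continuous_on {..a} (\<lambda>u. q (Complex u b))"
        by (rule continuous_on_compose2[OF holomorphic_on_imp_continuous_on[OF q] ray])
          (use assms(3) in auto)
    qed
    have maj: "set_integrable lborel {..a} (\<lambda>u. C * B * exp (u / 2))"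
      by (intro set_integrable_mult_right set_integrable_exp_half_atMost)
    have int: "set_integrable lborel {..a} ?h"
    proof (rule set_integrable_bound[OF maj])
      show "set_borel_measurable lborel {..a} ?h"
        using set_measurable_continuous_on[OF _ cont] by (simp add: set_borel_measurable_def)
      show "AE u in lborel. u \<in> {..a} \<longrightarrow> norm (?h u) \<le> norm (C * B * exp (u / 2))"
        using le C(1) \<open>B \<ge> 0\<close> by auto
    qed
    have "norm (LBINT u:{..a}. ?h u) \<le> (LBINT u:{..a}. norm (?h u))"
      by (rule set_integral_norm_bound[OF int])
    also have "\<dots> \<le> (LBINT u:{..a}. C * B * exp (u / 2))"
      using le maj int by (intro set_integral_mono) (auto simp: set_integrable_norm)
    also have "\<dots> = C * J * B" by (simp add: J_def)
    also have "\<dots> \<le> (C * J + 1) * B" using \<open>B \<ge> 0\<close> by (simp add: algebra_simps)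
    finally show ?thesis using int by blast
  qed
  note * = this
  have "C * J + 1 > 0" using C(1) \<open>J \<ge> 0\<close> by (simp add: add_nonneg_pos)
  then show ?thesis using * by (rule that)
qed

lemma hankel_image_subset_slit_plane:
  assumes "hankel_contour g"
  shows "hankel_image g \<subseteq> slit_plane"
  using assms by (auto simp: hankel_contour_def hankel_image_def left_ray_def complex_nonpos_Reals_iff)

text \<open>
  The factor \<open>exp t * t powr s\<close> has finite total mass on a Hankel contour, so the Hankel integral is
  a bounded functional of the remaining factor \<open>q\<close> in the supremum norm.  The two main uses are with the
  tails of the binomial series, to integrate that series term by term, and with pure powers of \<open>t\<close>, to
  estimate the reciprocal Gamma function.
\<close>

lemma hankel_integral_bound:
  fixes s :: complex
  assumes "hankel_contour g" and "open V" and "V \<subseteq> slit_plane" and "hankel_image g \<subseteq> V"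
  obtains L where "L > 0" and "\<And>q B. q holomorphic_on V \<Longrightarrow> (\<And>t. t \<in> V \<Longrightarrow> norm (q t) \<le> B) \<Longrightarrow>
      hankel_integrable (\<lambda>t. exp t * t powr s * q t) g \<and>
      norm (hankel_integral (\<lambda>t. exp t * t powr s * q t) g) \<le> L * B"
proof -
  note g = assms(1)[unfolded hankel_contour_def]
  let ?p1 = "pathstart g" and ?p2 = "pathfinish g" and ?k = "\<lambda>t. exp t * t powr s"
  have ray: "Complex u (Im ?p1) \<in> V" if "u \<le> Re ?p1" for u
    using assms(4) that by (auto simp: hankel_image_def left_ray_def)
  obtain L1 where L1: "L1 > 0" "\<And>q B. q holomorphic_on V \<Longrightarrow> (\<And>t. t \<in> V \<Longrightarrow> norm (q t) \<le> B) \<Longrightarrow>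
      set_integrable lborel {..Re ?p1} (\<lambda>u. ?k (Complex u (Im ?p1)) * q (Complex u (Im ?p1))) \<and>
      norm (LBINT u:{..Re ?p1}. ?k (Complex u (Im ?p1)) * q (Complex u (Im ?p1))) \<le> L1 * B"
    by (rule ray_integral_bound[of "Im ?p1" V "Re ?p1" s, OF _ assms(2) ray]) (use g in auto)
  have ray: "Complex u (Im ?p2) \<in> V" if "u \<le> Re ?p2" for u
    using assms(4) that by (auto simp: hankel_image_def left_ray_def)
  obtain L2 where L2: "L2 > 0" "\<And>q B. q holomorphic_on V \<Longrightarrow> (\<And>t. t \<in> V \<Longrightarrow> norm (q t) \<le> B) \<Longrightarrow>
      set_integrable lborel {..Re ?p2} (\<lambda>u. ?k (Complex u (Im ?p2)) * q (Complex u (Im ?p2))) \<and>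
      norm (LBINT u:{..Re ?p2}. ?k (Complex u (Im ?p2)) * q (Complex u (Im ?p2))) \<le> L2 * B"
    by (rule ray_integral_bound[of "Im ?p2" V "Re ?p2" s, OF _ assms(2) ray]) (use g in auto)
  have pg: "path_image g \<subseteq> V" using assms(4) by (auto simp: hankel_image_def)
  have kV: "?k holomorphic_on V"
    using holomorphic_on_kernel assms(3) holomorphic_on_subset by blast
  have "compact (?k ` path_image g)"
    using g pg holomorphic_on_imp_continuous_on[OF kV]
    by (intro compact_continuous_image) (auto intro: continuous_on_subset simp: compact_path_image valid_path_imp_path)
  then obtain M where M: "M > 0" "\<forall>w\<in>?k ` path_image g. norm w < M"
    using compact_imp_bounded bounded_pos_less by metis
  \<comment> \<open>The middle part needs a neighbourhood on which the first factor is bounded as well; on \<open>V\<close> it need not be.\<close>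
  define W where "W = V \<inter> ?k -` ball 0 M"
  have "open W" unfolding W_def
    by (intro continuous_open_preimage holomorphic_on_imp_continuous_on kV assms) auto
  moreover have "path_image g \<subseteq> W" using pg M by (auto simp: W_def)
  ultimately obtain L0 where L0: "L0 > 0" 
    "\<And>f B. f holomorphic_on W \<Longrightarrow> (\<forall>z \<in> W. norm(f z) \<le> B) \<Longrightarrow> norm(contour_integral g f) \<le> L0*B"
    using contour_integral_bound_exists[of W g] g by blast
  have "hankel_integrable (\<lambda>t. ?k t * q t) g \<and>
      norm (hankel_integral (\<lambda>t. ?k t * q t) g) \<le> (L1 + L0 * M + L2) * B" 
    if q: "q holomorphic_on V" and B: "\<And>t. t \<in> V \<Longrightarrow> norm (q t) \<le> B" for q B
  proof -
    have kq: "(\<lambda>t. ?k t * q t) holomorphic_on V"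
      by (rule holomorphic_on_mult[OF kV q])
    have "norm (contour_integral g (\<lambda>t. ?k t * q t)) \<le> L0 * (M * B)"
    proof (rule L0(2))
      show "(\<lambda>t. ?k t * q t) holomorphic_on W"
        using kq by (rule holomorphic_on_subset) (auto simp: W_def)
      show "\<forall>z\<in>W. norm (?k z * q z) \<le> M * B"
        unfolding norm_mult[of _ "q _"] using B M(1) by (auto simp: W_def intro!: mult_mono)
    qed
    moreover have "(\<lambda>t. ?k t * q t) contour_integrable_on g"
      using g pg assms(2) by (intro contour_integrable_holomorphic_simple[OF kq]) auto
    moreover have "norm (a + b - c) \<le> (L1 + L0 * M + L2) * B"
      if "norm a \<le> L1 * B" "norm b \<le> L0 * (M * B)" "norm c \<le> L2 * B" for a b c :: complex
      using norm_triangle_ineq[of a b] norm_triangle_ineq4[of "a + b" c] that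
      by (simp add: algebra_simps)
    ultimately show ?thesis
      using L1(2)[OF q B] L2(2)[OF q B] unfolding hankel_integrable_def hankel_integral_def
      by blast
  qed
  note * = this
  have "L1 + L0 * M + L2 > 0" using L0(1) L1(1) L2(1) M(1) by (simp add: add_pos_pos)
  then show ?thesis using * by (rule that)
qed

lemma hankel_integrable_kernel:
  assumes "hankel_contour g"
  shows "hankel_integrable (\<lambda>t. exp t * t powr s) g"
proof (rule hankel_integral_bound[where s = s, OF assms open_slit_plane order_refl
      hankel_image_subset_slit_plane[OF assms]])
  fix L
  assume L: "\<And>q B. q holomorphic_on slit_plane \<Longrightarrow> (\<And>t. t \<in> slit_plane \<Longrightarrow> norm (q t) \<le> B) \<Longrightarrow>
      hankel_integrable (\<lambda>t. exp t * t powr s * q t) g \<and>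
      norm (hankel_integral (\<lambda>t. exp t * t powr s * q t) g) \<le> L * B"
  from L[of "\<lambda>_. 1" 1] show ?thesis by simp
qed

section \<open>Hankel integrals through primitives\<close>

text \<open>
  Telescoping the primitive \<open>F\<close> over the two rays and the middle part cancels the values at the two
  corners.  What remains is the difference of \<open>F\<close> between the upper and the lower ray, far to the left.
  So the shape of the contour is irrelevant: this lemma takes the place of a contour deformation.
\<close>

lemma hankel_integral_eq_limit:
  assumes "hankel_contour g" and f: "f holomorphic_on slit_plane"
    and F: "\<And>t. t \<in> slit_plane \<Longrightarrow> (F has_field_derivative f t) (at t)"
    and int: "hankel_integrable f g"
    and lim: "((\<lambda>u. F (Complex u (Im (pathfinish g))) - F (Complex u (Im (pathstart g)))) \<longlongrightarrow> L) at_bot"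
  shows "hankel_integral f g = L"
proof -
  note g = assms(1)[unfolded hankel_contour_def]
  have ray: "((\<lambda>u. F (Complex a b) - F (Complex u b)) \<longlongrightarrow> (LBINT s:{..a}. f (Complex s b))) at_bot"
    if "b \<noteq> 0" and int: "set_integrable lborel {..a} (\<lambda>s. f (Complex s b))" for a b
  proof -
    have "(LBINT s:{u..a}. f (Complex s b)) = F (Complex a b) - F (Complex u b)" if "u \<le> a" for u
    proof -
      have "set_integrable lborel {u..a} (\<lambda>s. f (Complex s b))"
        by (rule set_integrable_subset[OF int]) auto
      then have "(LBINT s:{u..a}. f (Complex s b)) = integral {u..a} (\<lambda>s. f (Complex s b))"
        by (rule set_borel_integral_eq_integral)
      also have "((\<lambda>s. f (Complex s b)) has_integral F (Complex a b) - F (Complex u b)) {u..a}"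
      proof (intro fundamental_theorem_of_calculus that)
        fix x
        have "((\<lambda>s. Complex s b) has_vector_derivative 1) (at x within {u..a})"
          unfolding Complex_eq by (auto intro!: derivative_eq_intros)
        from field_vector_diff_chain_within[OF this has_field_derivative_at_within[OF F]]
        show "((\<lambda>s. F (Complex s b)) has_vector_derivative f (Complex x b)) (at x within {u..a})"
          using Complex_in_slit_plane[OF \<open>b \<noteq> 0\<close>] by (auto simp: o_def)
      qed
      then have "integral {u..a} (\<lambda>s. f (Complex s b)) = F (Complex a b) - F (Complex u b)"
        by (rule integral_unique)
      finally show ?thesis .
    qed
    then have "\<forall>\<^sub>F u in at_bot. (LBINT s:{u..a}. f (Complex s b)) = F (Complex a b) - F (Complex u b)"
      by (intro eventually_mono[OF eventually_le_at_bot[of a]])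
    with tendsto_set_lebesgue_integral_at_bot[OF _ int] show ?thesis
      by (auto intro: Lim_transform_eventually)
  qed
  have 1: "((\<lambda>u. F (pathstart g) - F (Complex u (Im (pathstart g)))) \<longlongrightarrow>
          (LBINT s:{..Re (pathstart g)}. f (Complex s (Im (pathstart g))))) at_bot"
    using ray[of "Im (pathstart g)" "Re (pathstart g)"] g int by (simp add: hankel_integrable_def)
  have 2: "((\<lambda>u. F (pathfinish g) - F (Complex u (Im (pathfinish g)))) \<longlongrightarrow>
          (LBINT s:{..Re (pathfinish g)}. f (Complex s (Im (pathfinish g))))) at_bot"
    using ray[of "Im (pathfinish g)" "Re (pathfinish g)"] g int by (simp add: hankel_integrable_def)
  have 3: "contour_integral g f = F (pathfinish g) - F (pathstart g)"
    using g by (intro contour_integral_unique contour_integral_primitive[of slit_plane])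
      (auto intro: F has_field_derivative_at_within)
  have "((\<lambda>u. F (Complex u (Im (pathfinish g))) - F (Complex u (Im (pathstart g)))) \<longlongrightarrow>
      hankel_integral f g) at_bot"
    using tendsto_add[OF tendsto_diff[OF 1 2] tendsto_const[of "contour_integral g f"]]
    unfolding hankel_integral_def 3 by (simp add: algebra_simps)
  then show ?thesis by (rule tendsto_unique[OF trivial_limit_at_bot_linorder _ lim])
qed

section \<open>Linearity of the Hankel integral\<close>

lemma hankel_integrable_add:
  assumes "hankel_integrable f g" "hankel_integrable h g"
  shows "hankel_integrable (\<lambda>t. f t + h t) g"
    and "hankel_integral (\<lambda>t. f t + h t) g = hankel_integral f g + hankel_integral h g"
  using assms unfolding hankel_integrable_def hankel_integral_def
  by (simp_all add: contour_integrable_add contour_integral_add)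

lemma hankel_integrable_cmult:
  assumes "hankel_integrable f g"
  shows "hankel_integrable (\<lambda>t. c * f t) g"
    and "hankel_integral (\<lambda>t. c * f t) g = c * hankel_integral f g"
  using assms unfolding hankel_integrable_def hankel_integral_def
  by (simp_all add: contour_integrable_lmul contour_integral_lmul algebra_simps)

lemma hankel_integrable_sum:
  assumes "finite I" "\<And>i. i \<in> I \<Longrightarrow> hankel_integrable (f i) g"
  shows "hankel_integrable (\<lambda>t. \<Sum>i\<in>I. f i t) g \<and>
    hankel_integral (\<lambda>t. \<Sum>i\<in>I. f i t) g = (\<Sum>i\<in>I. hankel_integral (f i) g)"
  using assms
proof (induction I rule: finite_induct)
  case empty
  then show ?case
    by (auto simp: hankel_integrable_def hankel_integral_def set_integrable_def
        contour_integrable_on_def intro: has_contour_integral_0)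
next
  case (insert i I)
  then show ?case
    using hankel_integrable_add[of "f i" g "\<lambda>t. \<Sum>i\<in>I. f i t"] by simp
qed

lemma hankel_integral_cong:
  assumes "\<And>t. t \<in> hankel_image g \<Longrightarrow> f t = h t"
  shows "hankel_integrable f g \<longleftrightarrow> hankel_integrable h g"
    and "hankel_integral f g = hankel_integral h g"
proof -
  have eq: "f (Complex u (Im (pathstart g))) = h (Complex u (Im (pathstart g)))"
    if "u \<le> Re (pathstart g)" for u
    using that assms by (auto simp: hankel_image_def left_ray_def)
  have eq': "f (Complex u (Im (pathfinish g))) = h (Complex u (Im (pathfinish g)))"
    if "u \<le> Re (pathfinish g)" for u
    using that assms by (auto simp: hankel_image_def left_ray_def)
  have eq'': "f t = h t" if "t \<in> path_image g" for t
    using that assms by (auto simp: hankel_image_def)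
  show "hankel_integrable f g \<longleftrightarrow> hankel_integrable h g"
    unfolding hankel_integrable_def
    by (intro arg_cong2[of _ _ _ _ "(\<and>)"] set_integrable_cong)
      (auto simp: eq eq' eq'' intro: contour_integrable_eq)
  show "hankel_integral f g = hankel_integral h g"
    unfolding hankel_integral_def
    by (intro arg_cong2[of _ _ _ _ "(+)"] arg_cong2[of _ _ _ _ "(-)"] set_lebesgue_integral_cong
        contour_integral_cong)
      (auto simp: eq eq' eq'')
qed

section \<open>Hankel's formula for the reciprocal Gamma function\<close>

text \<open>
  If the derivative of \<open>F\<close> decays to the left, uniformly in horizontal strips, then the height of a
  horizontal ray does not affect the limit of \<open>F\<close> along it.
\<close>

lemma vertical_shift_tendsto_0:
  assumes F: "\<And>t. Re t < 0 \<Longrightarrow> (F has_field_derivative f t) (at t)"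
    and f: "\<And>t. Re t \<le> -1 \<Longrightarrow> \<bar>Im t\<bar> \<le> \<bar>b\<bar> + \<bar>c\<bar> \<Longrightarrow> norm (f t) \<le> B (Re t)"
    and B: "(B \<longlongrightarrow> 0) at_bot"
  shows "((\<lambda>u. F (Complex u b) - F (Complex u c)) \<longlongrightarrow> 0) at_bot"
proof (rule Lim_null_comparison)
  show "\<forall>\<^sub>F u in at_bot. norm (F (Complex u b) - F (Complex u c)) \<le> B u * \<bar>b - c\<bar>"
    using eventually_le_at_bot[of "-1"]
  proof eventually_elim
    case (elim u)
    have seg: "Re t = u \<and> \<bar>Im t\<bar> \<le> \<bar>b\<bar> + \<bar>c\<bar>" 
      if t: "t \<in> closed_segment (Complex u b) (Complex u c)" for t
    proof -
      obtain x where x: "0 \<le> x" "x \<le> 1" "t = (1 - x) *\<^sub>R Complex u b + x *\<^sub>R Complex u c"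
        using t by (auto simp: closed_segment_def)
      have "\<bar>(1 - x) * b\<bar> \<le> \<bar>b\<bar>" "\<bar>x * c\<bar> \<le> \<bar>c\<bar>"
        using x by (simp_all add: abs_mult mult_left_le_one_le)
      then have "\<bar>(1 - x) * b + x * c\<bar> \<le> \<bar>b\<bar> + \<bar>c\<bar>" by linarith
      moreover have "(1 - x) * u + x * u = u" by (simp add: algebra_simps)
      ultimately show ?thesis using x by simp
    qed
    have "norm (F (Complex u b) - F (Complex u c)) \<le> B u * norm (Complex u b - Complex u c)"
    proof (rule field_differentiable_bound[where S = "closed_segment (Complex u b) (Complex u c)"])
      fix t assume "t \<in> closed_segment (Complex u b) (Complex u c)"
      note t = seg[OF this]
      show "(F has_field_derivative f t) (at t within closed_segment (Complex u b) (Complex u c))"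
        using t elim by (intro has_field_derivative_at_within[OF F]) auto
      show "norm (f t) \<le> B u"
        using t elim f[of t] by auto
    qed auto
    also have "norm (Complex u b - Complex u c) = \<bar>b - c\<bar>"
      by (simp add: cmod_def)
    finally show ?case .
  qed
  show "((\<lambda>u. B u * \<bar>b - c\<bar>) \<longlongrightarrow> 0) at_bot"
    using tendsto_mult[OF B tendsto_const[of "\<bar>b - c\<bar>"]] by simp
qed

text \<open>
  On the left half plane \<open>Ln (- t)\<close> is holomorphic across the cut of \<open>Ln t\<close>, and the two differ by a
  constant on each side of the cut.  The jump \<open>2 * \<pi> * \<i>\<close> between the two sides is the source of the value
  of every Hankel integral below.
\<close>

lemma Ln_eq_Ln_minus:
  assumes "Re t < 0"
  shows "Im t > 0 \<Longrightarrow> Ln t = Ln (- t) + \<i> * of_real pi"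
    and "Im t < 0 \<Longrightarrow> Ln t = Ln (- t) - \<i> * of_real pi"
proof -
  have "t \<noteq> 0" using assms by auto
  then show "Im t > 0 \<Longrightarrow> Ln t = Ln (- t) + \<i> * of_real pi"
    and "Im t < 0 \<Longrightarrow> Ln t = Ln (- t) - \<i> * of_real pi"
    using Ln_minus[of "- t"] assms by (auto simp: mult.commute)
qed

lemma minus_in_slit_plane: "Re t < 0 \<Longrightarrow> - t \<in> slit_plane"
  by (simp add: complex_nonpos_Reals_iff)

text \<open>
  The function \<open>G t\<close> is the sum of \<open>t ^ n / (n! * (n + a))\<close>.  The differential equation says that
  \<open>t powr a * G t\<close> is a primitive of \<open>exp t * t powr (a - 1)\<close>; up to a sign in the argument this is the
  lower incomplete Gamma function.
\<close>

lemma incomplete_gamma_series: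
  fixes a :: complex
  assumes "Re a > 0"
  obtains G G' where "\<And>t. (G has_field_derivative G' t) (at t)" and "\<And>t. a * G t + t * G' t = exp t"
proof -
  define c where "c = (\<lambda>n. 1 / (fact n * (of_nat n + a)))"
  have na: "norm (of_nat n + a) \<ge> Re a" "of_nat n + a \<noteq> 0" for n
    using complex_Re_le_cmod[of "of_nat n + a"] assms by (auto simp: complex_eq_iff)
  have summ: "summable (\<lambda>n. c n * y ^ n)" for y
  proof (rule summable_comparison_test)
    show "\<exists>N. \<forall>n\<ge>N. norm (c n * y ^ n) \<le> (norm y ^ n /\<^sub>R fact n) / Re a"
    proof (intro exI[of _ 0] allI impI)
      fix n
      have "norm (c n * y ^ n) = (norm y ^ n / fact n) / norm (of_nat n + a)"
        by (simp add: c_def norm_mult norm_divide norm_power)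
      also have "\<dots> \<le> (norm y ^ n / fact n) / Re a"
        using na[of n] assms by (intro divide_left_mono mult_pos_pos) auto
      finally show "norm (c n * y ^ n) \<le> (norm y ^ n /\<^sub>R fact n) / Re a"
        by (simp add: field_simps)
    qed
    show "summable (\<lambda>n. (norm y ^ n /\<^sub>R fact n) / Re a)"
      by (intro summable_divide summable_exp_generic)
  qed
  define G where "G = (\<lambda>t. \<Sum>n. c n * t ^ n)"
  define G' where "G' = (\<lambda>t. \<Sum>n. diffs c n * t ^ n)"
  have "a * G t + t * G' t = exp t" for t
  proof -
    have 1: "(\<lambda>n. a * (c n * t ^ n)) sums (a * G t)"
      unfolding G_def by (intro sums_mult summable_sums summ)
    have "(\<lambda>n. t * (of_nat n * c n * t ^ (n - Suc 0))) sums (t * G' t)"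
      unfolding G'_def by (intro sums_mult diffs_equiv termdiff_converges_all summ)
    also have "(\<lambda>n. t * (of_nat n * c n * t ^ (n - Suc 0))) = (\<lambda>n. of_nat n * (c n * t ^ n))"
    proof
      fix n show "t * (of_nat n * c n * t ^ (n - Suc 0)) = of_nat n * (c n * t ^ n)"
        by (cases n) (simp_all add: mult_ac)
    qed
    finally have "(\<lambda>n. a * (c n * t ^ n) + of_nat n * (c n * t ^ n)) sums (a * G t + t * G' t)"
      using 1 by (intro sums_add)
    also have "(\<lambda>n. a * (c n * t ^ n) + of_nat n * (c n * t ^ n)) = (\<lambda>n. t ^ n /\<^sub>R fact n)"
    proof
      fix n
      have "a * (c n * t ^ n) + of_nat n * (c n * t ^ n) = (of_nat n + a) * c n * t ^ n"
        by (simp add: algebra_simps)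
      also have "(of_nat n + a) * c n = 1 / fact n" using na[of n] by (simp add: c_def)
      finally show "a * (c n * t ^ n) + of_nat n * (c n * t ^ n) = t ^ n /\<^sub>R fact n"
        by (simp add: scaleR_conv_of_real field_simps)
    qed
    finally show ?thesis using exp_converges[of t] sums_unique2 by blast
  qed
  moreover have "(G has_field_derivative G' t) (at t)" for t
    unfolding G_def G'_def by (rule termdiffs_strong_converges_everywhere[OF summ])
  ultimately show ?thesis by (intro that)
qed

text \<open>
  By the fundamental theorem of calculus \<open>v powr a * G (- v)\<close> is Euler's integral for \<open>Gamma a\<close>
  cut off at \<open>v\<close>.
\<close>

lemma incomplete_gamma_tendsto_Gamma:
  fixes a :: complex and G :: "complex \<Rightarrow> complex"
  assumes a: "Re a > 0"
    and G: "\<And>t. (G has_field_derivative G' t) (at t)" and GG': "\<And>t. a * G t + t * G' t = exp t"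
  shows "((\<lambda>v. of_real v powr a * G (- of_real v)) \<longlongrightarrow> Gamma a) at_top"
proof -
  let ?f = "\<lambda>u::real. complex_of_real u powr (a - 1) / of_real (exp u)"
  let ?P = "\<lambda>v::real. complex_of_real v powr a * G (- of_real v)"
  have int: "?f absolutely_integrable_on {0..}"
  proof -
    \<comment> \<open>The integrand takes the value 0 at 0, because \<open>0 powr z = 0\<close>.\<close>
    have "(\<lambda>x. indicat_real {0..} x *\<^sub>R ?f x) = (\<lambda>x. indicat_real {0<..} x *\<^sub>R ?f x)"
      by (auto simp: fun_eq_iff indicator_def)
    then show ?thesis
      using absolutely_integrable_Gamma_integral'[OF a] by (simp add: set_integrable_def)
  qed
  have "(LINT u:{0..v}|lebesgue. ?f u) = ?P v" if "v \<ge> 0" for v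
  proof -
    have "(?f has_integral (?P v - ?P 0)) {0..v}"
    proof (rule fundamental_theorem_of_calculus_interior)
      have "continuous_on UNIV G"
        by (rule holomorphic_on_imp_continuous_on) (auto simp: holomorphic_on_open intro: G)
      then have "continuous_on {0..v} (\<lambda>v. G (- of_real v))"
        by (rule continuous_on_compose2) (auto intro!: continuous_intros)
      moreover have "continuous_on {0..v} (\<lambda>v. complex_of_real v powr a)"
        using a by (intro continuous_on_powr_complex continuous_intros) auto
      ultimately show "continuous_on {0..v} ?P" by (intro continuous_on_mult)
      fix x assume x: "x \<in> {0<..<v}"
      then have x': "complex_of_real x \<notin> \<real>\<^sub>\<le>\<^sub>0" by auto
      have "((\<lambda>w. w powr a * G (- w)) has_field_derivative
          (a * of_real x powr (a - 1) * G (- of_real x) + G' (- of_real x) * (-1) * of_real x powr a))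
          (at (of_real x))"
        by (rule derivative_eq_intros DERIV_chain2[OF G] x' refl | simp)+
      also have "a * of_real x powr (a - 1) * G (- of_real x) + G' (- of_real x) * (-1) * of_real x powr a
          = of_real x powr (a - 1) * (a * G (- of_real x) + (- of_real x) * G' (- of_real x))"
        using x by (simp add: powr_diff field_simps)
      also have "\<dots> = ?f x" unfolding GG' by (simp add: exp_minus field_simps exp_of_real)
      finally show "(?P has_vector_derivative ?f x) (at x)"
        by (rule has_vector_derivative_real_field)
    qed (use that in auto)
    then have "integral {0..v} ?f = ?P v" by (simp add: integral_unique)
    moreover have "?f absolutely_integrable_on {0..v}"
      by (rule set_integrable_subset[OF int]) auto
    ultimately show ?thesis by (simp add: set_lebesgue_integral_eq_integral)
  qed
  then have "\<forall>\<^sub>F v in at_top. (LINT u:{0..v}|lebesgue. ?f u) = ?P v"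
    by (intro eventually_mono[OF eventually_ge_at_top[of 0]])
  moreover have "((\<lambda>v. LINT u:{0..v}|lebesgue. ?f u) \<longlongrightarrow> (LINT u:{0..}|lebesgue. ?f u)) at_top"
    using int by (intro tendsto_set_lebesgue_integral_at_top) auto
  moreover have "(LINT u:{0..}|lebesgue. ?f u) = Gamma a"
    using Gamma_integral_complex[OF a] int
    by (simp add: set_lebesgue_integral_eq_integral integral_unique)
  ultimately show ?thesis by (auto intro: Lim_transform_eventually)
qed

text \<open>
  With \<open>a = 1 - s\<close> the primitive \<open>t powr a * G t\<close> of the integrand equals \<open>exp (\<plusminus> \<i> * pi * a)\<close> times
  \<open>(- t) powr a * G t\<close> on the two sides of the cut, and the latter function tends to \<open>Gamma a\<close> to the left.
  Hence the integral is \<open>2 * \<i> * sin (pi * a) * Gamma a\<close>, and the reflection formula turns this into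
  \<open>rGamma s\<close>.
\<close>

lemma hankel_integral_rGamma_left:
  assumes g: "hankel_contour g" and s: "Re s < 1"
  shows "hankel_integral (\<lambda>t. exp t * t powr (- s)) g = 2 * of_real pi * \<i> * rGamma s"
proof -
  define a where "a = 1 - s"
  have a: "Re a > 0" using s by (simp add: a_def)
  obtain G G' where G: "\<And>t. (G has_field_derivative G' t) (at t)"
      and GG': "\<And>t. a * G t + t * G' t = exp t"
    using incomplete_gamma_series[OF a] by blast
  define p where "p = (\<lambda>t. (- t) powr a * G t)"
  have p': "(p has_field_derivative - (exp t * (- t) powr (a - 1))) (at t)" if "Re t < 0" for t
  proof -
    have t: "- t \<notin> \<real>\<^sub>\<le>\<^sub>0" "t \<noteq> 0" using minus_in_slit_plane[OF that] that by auto
    have "(p has_field_derivative (a * (- t) powr (a - 1) * (-1) * G t + G' t * (- t) powr a)) (at t)"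
      unfolding p_def by (rule derivative_eq_intros G t refl | simp)+
    also have "a * (- t) powr (a - 1) * (-1) * G t + G' t * (- t) powr a
        = - ((- t) powr (a - 1) * (a * G t + t * G' t))"
      using t by (simp add: powr_diff field_simps)
    finally show ?thesis unfolding GG' by (simp add: mult.commute)
  qed
  obtain C where C: "C > 0" "\<And>t::complex. norm t \<ge> 1 \<Longrightarrow> norm (t powr (a - 1)) \<le> C * exp (norm t / 2)"
    using norm_powr_le_exp[of 1 "a - 1"] by auto
  have p_lim: "((\<lambda>u. p (Complex u b)) \<longlongrightarrow> Gamma a) at_bot" for b
  proof -
    have "((\<lambda>u. p (Complex u b) - p (Complex u 0)) \<longlongrightarrow> 0) at_bot"
    proof (rule vertical_shift_tendsto_0[OF p'])
      fix t assume t: "Re t \<le> -1" "\<bar>Im t\<bar> \<le> \<bar>b\<bar> + \<bar>0\<bar>"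
      have n: "norm t \<ge> 1" using abs_Re_le_cmod[of t] t by linarith
      have "norm (- (exp t * (- t) powr (a - 1))) \<le> exp (Re t) * (C * exp (norm t / 2))"
        using C(2)[of "- t"] n by (simp add: norm_mult)
      also have "\<dots> = C * exp (Re t + norm t / 2)" by (simp add: exp_add)
      also have "\<dots> \<le> C * exp (Re t / 2 + \<bar>b\<bar> / 2)"
        using C t cmod_le[of t] by (auto intro!: mult_left_mono)
      finally show "norm (- (exp t * (- t) powr (a - 1))) \<le> C * exp (Re t / 2 + \<bar>b\<bar> / 2)" .
    next
      show "((\<lambda>x. C * exp (x / 2 + \<bar>b\<bar> / 2)) \<longlongrightarrow> 0) at_bot" by real_asymp
    qed
    moreover have "((\<lambda>u. p (Complex u 0)) \<longlongrightarrow> Gamma a) at_bot"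
      using incomplete_gamma_tendsto_Gamma[OF a G GG']
      unfolding at_bot_mirror filterlim_filtermap
      by (simp add: p_def complex_of_real_def[symmetric] flip: of_real_minus)
    ultimately show ?thesis using tendsto_add by fastforce
  qed
  let ?b1 = "Im (pathstart g)" and ?b2 = "Im (pathfinish g)"
  have b: "?b1 < 0" "?b2 > 0" using g by (auto simp: hankel_contour_def)
  define F where "F = (\<lambda>t. t powr a * G t)"
  have F': "(F has_field_derivative exp t * t powr (- s)) (at t)" if "t \<in> slit_plane" for t
  proof -
    have t: "t \<notin> \<real>\<^sub>\<le>\<^sub>0" "t \<noteq> 0" using that by auto
    have "(F has_field_derivative (a * t powr (a - 1) * G t + G' t * t powr a)) (at t)"
      unfolding F_def by (rule derivative_eq_intros G t refl | simp)+
    also have "a * t powr (a - 1) * G t + G' t * t powr a = t powr (a - 1) * (a * G t + t * G' t)"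
      using t by (auto simp add: powr_diff field_simps)
    finally show ?thesis unfolding GG' by (simp add: mult.commute a_def)
  qed
  have "hankel_integral (\<lambda>t. exp t * t powr (- s)) g
      = exp (\<i> * of_real pi * a) * Gamma a - exp (- (\<i> * of_real pi * a)) * Gamma a"
  proof (rule hankel_integral_eq_limit[OF g holomorphic_on_kernel F' hankel_integrable_kernel[OF g]])
    have "((\<lambda>u. exp (\<i> * of_real pi * a) * p (Complex u ?b2) - exp (- (\<i> * of_real pi * a)) * p (Complex u ?b1))
      \<longlongrightarrow> exp (\<i> * of_real pi * a) * Gamma a - exp (- (\<i> * of_real pi * a)) * Gamma a) at_bot"
      by (intro tendsto_intros p_lim)
    moreover have "\<forall>\<^sub>F u in at_bot. exp (\<i> * of_real pi * a) * p (Complex u ?b2) - exp (- (\<i> * of_real pi * a)) * p (Complex u ?b1) = F (Complex u ?b2) - F (Complex u ?b1)"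
      using eventually_le_at_bot[of "-1"]
    proof eventually_elim
      case (elim u)
      have "F (Complex u ?b2) = exp (\<i> * of_real pi * a) * p (Complex u ?b2)"
        using Ln_eq_Ln_minus(1)[of "Complex u ?b2"] elim b
        by (auto simp: F_def p_def powr_def mult_exp_exp algebra_simps)
      moreover have "F (Complex u ?b1) = exp (- (\<i> * of_real pi * a)) * p (Complex u ?b1)"
      proof -
        have Ln: "Ln (Complex u ?b1) = Ln (- Complex u ?b1) - \<i> * of_real pi"
          using Ln_eq_Ln_minus(2)[of "Complex u ?b1"] elim b by simp
        have "a * (Ln (- Complex u ?b1) - \<i> * of_real pi) = - (\<i> * of_real pi * a) + a * Ln (- Complex u ?b1)"
          by (simp add: algebra_simps)
        then have "exp (a * Ln (Complex u ?b1)) = exp (- (\<i> * of_real pi * a)) * exp (a * Ln (- Complex u ?b1))"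
          by (simp only: Ln exp_add)
        then show ?thesis
          using b by (simp add: F_def p_def powr_def Complex_eq_0)
      qed
      ultimately show ?case by simp
    qed
    ultimately show "((\<lambda>u. F (Complex u ?b2) - F (Complex u ?b1)) \<longlongrightarrow>
        exp (\<i> * of_real pi * a) * Gamma a - exp (- (\<i> * of_real pi * a)) * Gamma a) at_bot"
      by (rule Lim_transform_eventually)
  qed
  also have "\<dots> = 2 * \<i> * (sin (of_real pi * a) * Gamma a)"
    by (simp add: sin_exp_eq field_simps)
  also have "sin (of_real pi * a) * Gamma a = of_real pi * rGamma s"
  proof -
    have "rGamma a \<noteq> 0" using a by (auto simp: rGamma_eq_zero_iff nonpos_Ints_def)
    moreover have "rGamma a * rGamma s = sin (of_real pi * a) / of_real pi"
      using rGamma_reflection_complex[of a] by (simp add: a_def)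
    ultimately show ?thesis by (simp add: Gamma_def field_simps)
  qed
  finally show ?thesis by simp
qed

text \<open>
  The recurrence for the Hankel integral cannot reach \<open>s = 1\<close> from \<open>s = 0\<close>, where it reads
  \<open>0 = 0\<close>.  For \<open>s = 1\<close> the primitive is \<open>Ln\<close> plus the entire primitive \<open>Q\<close> of \<open>(exp t - 1) / t\<close>, and only
  the logarithm jumps across the cut.
\<close>

lemma hankel_integral_rGamma_1:
  assumes g: "hankel_contour g"
  shows "hankel_integral (\<lambda>t. exp t * t powr (- 1)) g = 2 * of_real pi * \<i>"
proof -
  let ?q = "\<lambda>z::complex. if z = 0 then deriv exp 0 else (exp z - exp 0) / (z - 0)"
  have "?q holomorphic_on UNIV"
    by (rule pole_lemma) (auto intro!: holomorphic_intros)
  then obtain Q where Q: "\<And>t. (Q has_field_derivative ?q t) (at t)"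
    using holomorphic_starlike_primitive[of UNIV ?q "{}"]
    by (auto simp: holomorphic_on_imp_continuous_on holomorphic_on_open field_differentiable_def)
  let ?b1 = "Im (pathstart g)" and ?b2 = "Im (pathfinish g)"
  have b: "?b1 < 0" "?b2 > 0" using g by (auto simp: hankel_contour_def)
  show ?thesis
  proof (rule hankel_integral_eq_limit[OF g holomorphic_on_kernel _ hankel_integrable_kernel[OF g]])
    fix t assume "t \<in> slit_plane"
    then have t: "t \<notin> \<real>\<^sub>\<le>\<^sub>0" "t \<noteq> 0" by auto
    have "((\<lambda>t. Ln t + Q t) has_field_derivative inverse t + ?q t) (at t)"
      by (rule derivative_eq_intros Q t refl | simp)+
    also have "inverse t + ?q t = exp t * t powr (- 1)"
      using t by (simp add: powr_minus field_simps)
    finally show "((\<lambda>t. Ln t + Q t) has_field_derivative exp t * t powr (- 1)) (at t)" .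
  next
    have "((\<lambda>u. (Ln (- Complex u ?b2) + Q (Complex u ?b2)) - (Ln (- Complex u ?b1) + Q (Complex u ?b1))) \<longlongrightarrow> 0) at_bot"
    proof (rule vertical_shift_tendsto_0[where F = "\<lambda>t. Ln (- t) + Q t"])
      fix t :: complex assume t: "Re t < 0"
      then have t': "- t \<notin> \<real>\<^sub>\<le>\<^sub>0" "t \<noteq> 0" using minus_in_slit_plane by auto
      have "((\<lambda>t. Ln (- t) + Q t) has_field_derivative inverse (- t) * (-1) + ?q t) (at t)"
        by (rule derivative_eq_intros Q t' refl | simp)+
      also have "inverse (- t) * (-1) + ?q t = exp t / t"
        using t' by (simp add: field_simps)
      finally show "((\<lambda>t. Ln (- t) + Q t) has_field_derivative exp t / t) (at t)" .
    next
      fix t :: complex assume t: "Re t \<le> -1"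
      then have "norm t \<ge> 1" using abs_Re_le_cmod[of t] by linarith
      then show "norm (exp t / t) \<le> exp (Re t)" by (simp add: norm_divide divide_le_eq)
    next
      show "(exp \<longlongrightarrow> (0::real)) at_bot" by (rule exp_at_bot)
    qed
    then have "((\<lambda>u. 2 * of_real pi * \<i> + ((Ln (- Complex u ?b2) + Q (Complex u ?b2)) - (Ln (- Complex u ?b1) + Q (Complex u ?b1))))
       \<longlongrightarrow> 2 * of_real pi * \<i> + 0) at_bot"
      by (intro tendsto_add tendsto_const)
    moreover have "\<forall>\<^sub>F u in at_bot. 2 * of_real pi * \<i> + ((Ln (- Complex u ?b2) + Q (Complex u ?b2)) - (Ln (- Complex u ?b1) + Q (Complex u ?b1)))
      = Ln (Complex u ?b2) + Q (Complex u ?b2) - (Ln (Complex u ?b1) + Q (Complex u ?b1))"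
      using eventually_le_at_bot[of "-1"]
    proof eventually_elim
      case (elim u)
      then show ?case
        using Ln_eq_Ln_minus(1)[of "Complex u ?b2"] Ln_eq_Ln_minus(2)[of "Complex u ?b1"] b
        by (simp add: algebra_simps)
    qed
    ultimately show "((\<lambda>u. Ln (Complex u ?b2) + Q (Complex u ?b2) - (Ln (Complex u ?b1) + Q (Complex u ?b1)))
       \<longlongrightarrow> 2 * of_real pi * \<i>) at_bot"
      by (auto intro: Lim_transform_eventually)
  qed
qed

text \<open>
  Integration by parts; the boundary terms vanish at the far left end of both rays.
\<close>

lemma hankel_integral_recurrence:
  assumes g: "hankel_contour g"
  shows "hankel_integral (\<lambda>t. exp t * t powr (- s)) g
    = s * hankel_integral (\<lambda>t. exp t * t powr (- (s + 1))) g"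
proof -
  let ?b1 = "Im (pathstart g)" and ?b2 = "Im (pathfinish g)"
  let ?f = "\<lambda>t. exp t * t powr (- s) + (- s) * (exp t * t powr (- (s + 1)))"
  note int = hankel_integrable_kernel[OF g]
  note sum = hankel_integrable_add[OF int hankel_integrable_cmult(1)[OF int]]
  obtain C where C: "C > 0" "\<And>t. norm t \<ge> 1 \<Longrightarrow> Re t \<le> 0 \<Longrightarrow> \<bar>Im t\<bar> \<le> max \<bar>?b1\<bar> \<bar>?b2\<bar> \<Longrightarrow>
        norm (exp t * t powr (- s)) \<le> C * exp (Re t / 2)"
    using norm_kernel_le_exp_Re[of 1 0 "max \<bar>?b1\<bar> \<bar>?b2\<bar>" "- s"] by auto
  have lim: "((\<lambda>u. exp (Complex u b) * Complex u b powr (- s)) \<longlongrightarrow> 0) at_bot"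
    if b: "\<bar>b\<bar> \<le> max \<bar>?b1\<bar> \<bar>?b2\<bar>" for b
  proof (rule Lim_null_comparison)
    show "\<forall>\<^sub>F u in at_bot. norm (exp (Complex u b) * Complex u b powr (- s)) \<le> C * exp (u / 2)"
      using eventually_le_at_bot[of "-1"]
    proof eventually_elim
      case (elim u)
      then show ?case
        using C(2)[of "Complex u b"] b abs_Re_le_cmod[of "Complex u b"] by simp
    qed
    show "((\<lambda>u. C * exp (u / 2)) \<longlongrightarrow> 0) at_bot" by real_asymp
  qed
  have "hankel_integral ?f g = 0 - 0"
  proof (rule hankel_integral_eq_limit[OF g])
    show "?f holomorphic_on slit_plane"
      by (intro holomorphic_on_add holomorphic_on_mult[OF holomorphic_on_const] holomorphic_on_kernel)
    show "hankel_integrable ?f g" by (rule sum)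
    show "((\<lambda>t. exp t * t powr (- s)) has_field_derivative ?f t) (at t)" if "t \<in> slit_plane" for t
    proof -
      have t: "t \<notin> \<real>\<^sub>\<le>\<^sub>0" using that by simp
      have "((\<lambda>t. exp t * t powr (- s)) has_field_derivative
         exp t * t powr (- s) + (- s) * t powr (- s - 1) * exp t) (at t)"
        by (rule derivative_eq_intros t refl | simp)+
      then show ?thesis by (simp add: mult_ac)
    qed
    show "((\<lambda>u. exp (Complex u ?b2) * Complex u ?b2 powr (- s) - exp (Complex u ?b1) * Complex u ?b1 powr (- s))
        \<longlongrightarrow> 0 - 0) at_bot"
      by (intro tendsto_diff lim) auto
  qed
  moreover have "hankel_integral ?f g = hankel_integral (\<lambda>t. exp t * t powr (- s)) g
      + (- s) * hankel_integral (\<lambda>t. exp t * t powr (- (s + 1))) g"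
    using hankel_integrable_add(2)[OF int hankel_integrable_cmult(1)[OF int]]
      hankel_integrable_cmult(2)[OF int] by presburger
  ultimately show ?thesis by simp
qed

text \<open>
  Hankel's formula.  The recurrences for the integral and for \<open>rGamma\<close> agree, so the formula extends
  from the half plane \<open>Re s < 1\<close> to the right, one unit strip at a time.
\<close>

theorem hankel_integral_rGamma:
  assumes g: "hankel_contour g"
  shows "hankel_integral (\<lambda>t. exp t * t powr (- s)) g = 2 * of_real pi * \<i> * rGamma s"
proof -
  have "hankel_integral (\<lambda>t. exp t * t powr (- s)) g = 2 * of_real pi * \<i> * rGamma s"
    if "Re s < 1 + real n" for n
    using that
  proof (induction n arbitrary: s)
    case 0
    then show ?case using hankel_integral_rGamma_left[OF g] by simp
  next
    case (Suc n)
    show ?case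
    proof (cases "s = 1")
      case True
      then show ?thesis using hankel_integral_rGamma_1[OF g] by simp
    next
      case False
      have "(s - 1) * hankel_integral (\<lambda>t. exp t * t powr (- s)) g = 2 * of_real pi * \<i> * rGamma (s - 1)"
        using Suc.IH[of "s - 1"] Suc.prems hankel_integral_recurrence[OF g, of "s - 1"] by simp
      also have "rGamma (s - 1) = (s - 1) * rGamma s"
        using rGamma_plus1[of "s - 1"] by simp
      finally show ?thesis using False by simp
    qed
  qed
  from this[of "nat \<lceil>\<bar>Re s\<bar>\<rceil>"] show ?thesis by linarith
qed

section \<open>Absolute convergence of the double series\<close>

text \<open>
  Geometric decay in \<open>k + l\<close> makes the double family absolutely summable, so that its sum may be
  arranged by rows or by diagonals.
\<close>

lemma double_series_diagonal_sums:
  fixes f :: "nat \<Rightarrow> nat \<Rightarrow> 'a :: banach"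
  assumes \<rho>: "0 \<le> \<rho>" "\<rho> < 1" and f: "\<And>k l. norm (f k l) \<le> C * \<rho> ^ (k + l)"
  shows "(\<lambda>n. \<Sum>k\<le>n. f k (n - k)) sums (\<Sum>k. \<Sum>l. f k l)"
proof -
  have geo: "((\<lambda>n. \<rho> ^ n) has_sum (1 / (1 - \<rho>))) UNIV"
    using geometric_sums[of \<rho>] \<rho> by (intro sums_nonneg_imp_has_sum) auto
  have "C \<ge> 0" using f[of 0 0] norm_ge_zero[of "f 0 0"] by (simp del: norm_ge_zero)
  have "(\<lambda>(k, l). C * \<rho> ^ (k + l)) summable_on (UNIV \<times> UNIV)"
  proof (rule summable_on_SigmaI)
    fix k :: nat
    show "((\<lambda>l. (\<lambda>(k, l). C * \<rho> ^ (k + l)) (k, l)) has_sum (C * \<rho> ^ k * (1 / (1 - \<rho>)))) UNIV"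
      using has_sum_cmult_right[OF geo, of "C * \<rho> ^ k"] by (simp add: power_add mult.assoc)
  next
    show "(\<lambda>k. C * \<rho> ^ k * (1 / (1 - \<rho>))) summable_on UNIV"
      by (rule summable_on_cmult_left[OF summable_on_cmult_right[OF has_sum_imp_summable[OF geo]]])
  qed (use \<open>C \<ge> 0\<close> \<rho> in auto)
  then have "(\<lambda>p. norm (case p of (k, l) \<Rightarrow> f k l)) summable_on (UNIV \<times> UNIV)"
    by (rule Infinite_Sum.abs_summable_on_comparison_test') (use f in auto)
  then have "(\<lambda>(k, l). f k l) summable_on (UNIV \<times> UNIV)"
    by (rule abs_summable_summable)
  then obtain S where S: "((\<lambda>(k, l). f k l) has_sum S) (UNIV \<times> UNIV)"
    by (auto simp: summable_on_def)
  have "(f k has_sum (\<Sum>l. f k l)) UNIV" for k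
  proof (rule norm_summable_imp_has_sum)
    show "summable (\<lambda>l. norm (f k l))"
    proof (rule summable_comparison_test)
      show "\<exists>N. \<forall>l\<ge>N. norm (norm (f k l)) \<le> C * \<rho> ^ k * \<rho> ^ l"
        using f by (auto simp: power_add mult.assoc)
      show "summable (\<lambda>l. C * \<rho> ^ k * \<rho> ^ l)"
        using \<rho> by (intro summable_mult summable_geometric) auto
    qed
    then show "f k sums (\<Sum>l. f k l)" by (rule summable_sums[OF summable_norm_cancel])
  qed
  then have "((\<lambda>k. \<Sum>l. f k l) has_sum S) UNIV"
    by (rule has_sum_SigmaD[OF S, unfolded prod.case])
  then have rows: "(\<Sum>k. \<Sum>l. f k l) = S" by (rule sums_unique[OF has_sum_imp_sums, symmetric])
  have "((\<lambda>(k, l). f k l) has_sum S) (UNIV \<times> UNIV) \<longleftrightarrow>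
      ((\<lambda>(n, k). f k (n - k)) has_sum S) (SIGMA n:UNIV. {..n})"
    by (rule has_sum_reindex_bij_witness[of _ "\<lambda>(n, k). (k, n - k)" "\<lambda>(k, l). (k + l, k)"]) auto
  with S have diagonal: "((\<lambda>(n, k). f k (n - k)) has_sum S) (SIGMA n:UNIV. {..n})"
    by (rule iffD1[rotated])
  have "((\<lambda>n. \<Sum>k\<le>n. f k (n - k)) has_sum S) UNIV"
    by (rule has_sum_SigmaD[OF diagonal, unfolded prod.case]) (rule has_sum_finite, simp)
  then show ?thesis unfolding rows by (rule has_sum_imp_sums)
qed

lemma neg_binomial_sums:
  fixes \<delta> z :: complex
  assumes "norm z < 1"
  shows "(\<lambda>n. pochhammer \<delta> n / fact n * z ^ n) sums (1 - z) powr (- \<delta>)"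
proof -
  have "(\<lambda>n. (- \<delta> gchoose n) * (- z) ^ n) sums (1 + (- z)) powr (- \<delta>)"
    using assms by (intro gen_binomial_complex) auto
  also have "(\<lambda>n. (- \<delta> gchoose n) * (- z) ^ n) = (\<lambda>n. pochhammer \<delta> n / fact n * z ^ n)"
  proof
    fix n
    have "(- z) ^ n = (-1) ^ n * z ^ n" by (metis mult_minus1 power_mult_distrib)
    then show "(- \<delta> gchoose n) * (- z) ^ n = pochhammer \<delta> n / fact n * z ^ n"
      by (simp add: gbinomial_pochhammer flip: power_mult_distrib mult.assoc)
  qed
  finally show ?thesis by simp
qed

lemma neg_binomial_norm_summable:
  fixes \<delta> :: complex
  assumes "0 \<le> r" "r < 1"
  shows "summable (\<lambda>n. norm (pochhammer \<delta> n / fact n) * r ^ n)"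
proof -
  obtain r' where r': "r < r'" "r' < 1" using assms dense by blast
  have "summable (\<lambda>n. pochhammer \<delta> n / fact n * (of_real r') ^ n)"
    using neg_binomial_sums[of "of_real r'" \<delta>] r' assms by (auto simp: sums_iff)
  from powser_insidea[OF this, of "of_real r"] r' assms show ?thesis
    by (simp add: norm_mult norm_power norm_divide)
qed

lemma kernel_times_powers:
  fixes t :: complex
  assumes "t \<noteq> 0"
  shows "exp t * t powr (- \<gamma>) * ((t powr (- \<alpha>)) ^ k * (t powr (- \<beta>)) ^ l)
    = exp t * t powr (- (\<alpha> * of_nat k + \<beta> * of_nat l + \<gamma>))"
proof -
  have "t powr (- \<gamma>) * ((t powr (- \<alpha>)) ^ k * (t powr (- \<beta>)) ^ l)
      = exp (- \<gamma> * Ln t + (of_nat k * (- \<alpha> * Ln t) + of_nat l * (- \<beta> * Ln t)))"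
    using assms by (simp only: powr_def if_False exp_add exp_of_nat_mult)
  also have "- \<gamma> * Ln t + (of_nat k * (- \<alpha> * Ln t) + of_nat l * (- \<beta> * Ln t))
      = - (\<alpha> * of_nat k + \<beta> * of_nat l + \<gamma>) * Ln t"
    by (simp add: algebra_simps)
  finally show ?thesis using assms by (simp only: powr_def if_False mult.assoc)
qed

text \<open>
  The reciprocal Gamma function decays faster than any geometric sequence along the lattice
  \<open>\<alpha> k + \<beta> l + \<gamma>\<close>.  The reason is that Hankel's formula may be evaluated on a contour
  so far from the origin that \<open>t powr (-\<alpha>)\<close> and \<open>t powr (-\<beta>)\<close> are smaller than \<open>\<epsilon>\<close> in norm, and each
  further unit of \<open>k\<close> or \<open>l\<close> then contributes another factor \<open>\<epsilon>\<close>.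
\<close>

lemma rGamma_lattice_bound:
  fixes \<alpha> \<beta> \<gamma> :: complex
  assumes "Re \<alpha> > 0" "Re \<beta> > 0" "\<epsilon> > 0"
  shows "\<exists>C. \<forall>k l. norm (rGamma (\<alpha> * of_nat k + \<beta> * of_nat l + \<gamma>)) \<le> C * \<epsilon> ^ (k + l)"
proof -
  obtain R1 where R1: "R1 > 0" "\<And>t. norm t \<ge> R1 \<Longrightarrow> norm (1 * t powr (-\<alpha>)) < \<epsilon>"
    using norm_powr_neg_small[OF assms(1,3), of 1] by blast
  obtain R2 where R2: "R2 > 0" "\<And>t. norm t \<ge> R2 \<Longrightarrow> norm (1 * t powr (-\<beta>)) < \<epsilon>"
    using norm_powr_neg_small[OF assms(2,3), of 1] by blast
  define R where "R = max R1 R2"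
  obtain g where g: "hankel_contour g" and far: "\<And>t. t \<in> hankel_image g \<Longrightarrow> norm t \<ge> R + 1"
    using ex_hankel_contour_far[of "R + 1"] by blast
  define V where "V = slit_plane \<inter> (- cball 0 R)"
  have "open V" unfolding V_def by (intro open_Int open_slit_plane open_Compl closed_cball)
  moreover have "V \<subseteq> slit_plane" by (simp add: V_def)
  moreover have "hankel_image g \<subseteq> V"
    using hankel_image_subset_slit_plane[OF g] far by (force simp: V_def)
  ultimately show ?thesis
  proof (rule hankel_integral_bound[OF g, where s = "- \<gamma>"])
    fix L
    assume L: "\<And>q B. q holomorphic_on V \<Longrightarrow> (\<And>t. t \<in> V \<Longrightarrow> norm (q t) \<le> B) \<Longrightarrow>
      hankel_integrable (\<lambda>t. exp t * t powr (- \<gamma>) * q t) g \<and>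
      norm (hankel_integral (\<lambda>t. exp t * t powr (- \<gamma>) * q t) g) \<le> L * B"
    have "norm (rGamma (\<alpha> * of_nat k + \<beta> * of_nat l + \<gamma>)) \<le> L / (2 * pi) * \<epsilon> ^ (k + l)" for k l
    proof -
      let ?q = "\<lambda>t. (t powr (- \<alpha>)) ^ k * (t powr (- \<beta>)) ^ l"
      have "?q holomorphic_on V"
        by (auto simp: V_def intro!: holomorphic_intros)
      moreover have "norm (?q t) \<le> \<epsilon> ^ (k + l)" if "t \<in> V" for t
      proof -
        have "norm (t powr (- \<alpha>)) \<le> \<epsilon>" "norm (t powr (- \<beta>)) \<le> \<epsilon>"
          using R1(2)[of t] R2(2)[of t] that unfolding V_def R_def by (simp_all add: not_le)
        then show ?thesis
          using assms(3) unfolding norm_mult norm_power power_add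
          by (intro mult_mono power_mono) auto
      qed
      ultimately have "norm (hankel_integral (\<lambda>t. exp t * t powr (- \<gamma>) * ?q t) g) \<le> L * \<epsilon> ^ (k + l)"
        using L by blast
      also have "hankel_integral (\<lambda>t. exp t * t powr (- \<gamma>) * ?q t) g
          = hankel_integral (\<lambda>t. exp t * t powr (- (\<alpha> * of_nat k + \<beta> * of_nat l + \<gamma>))) g"
        using hankel_image_subset_slit_plane[OF g]
        by (intro hankel_integral_cong kernel_times_powers) auto
      also have "\<dots> = 2 * of_real pi * \<i> * rGamma (\<alpha> * of_nat k + \<beta> * of_nat l + \<gamma>)"
        by (rule hankel_integral_rGamma[OF g])
      finally show ?thesis by (simp add: norm_mult field_simps)
    qed
    then have "\<forall>k l. norm (rGamma (\<alpha> * of_nat k + \<beta> * of_nat l + \<gamma>)) \<le> L / (2 * pi) * \<epsilon> ^ (k + l)"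
      by blast
    then show ?thesis by (rule exI)
  qed
qed

text \<open>
  The ratio \<open>2/3\<close> arises as follows: choosing \<open>\<epsilon>\<close> small absorbs \<open>x\<close> and \<open>y\<close> into
  \<open>(1/4) ^ (k + l)\<close>, the binomial coefficient costs \<open>2 ^ (k + l)\<close>, and the coefficients of the negative
  binomial series, whose radius of convergence is at least 1, cost a constant times \<open>(4/3) ^ (k + l)\<close>.
\<close>

lemma mittag_leffler_term_bound:
  fixes \<alpha> \<beta> \<gamma> \<delta> x y :: complex
  assumes "Re \<alpha> > 0" "Re \<beta> > 0"
  shows "\<exists>C. \<forall>k l. norm (pochhammer \<delta> (k + l) * rGamma (\<alpha> * of_nat k + \<beta> * of_nat l + \<gamma>)
      * (x ^ k * y ^ l / (fact k * fact l))) \<le> C * (2 / 3) ^ (k + l)"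
proof -
  define \<epsilon> where "\<epsilon> = 1 / (4 * (norm x + norm y + 1))"
  have pos: "norm x + norm y + 1 > 0" by (simp add: add_nonneg_pos)
  then have \<epsilon>: "\<epsilon> > 0" by (simp add: \<epsilon>_def)
  have xy: "norm x * \<epsilon> \<le> 1 / 4" "norm y * \<epsilon> \<le> 1 / 4"
    using pos by (simp_all add: \<epsilon>_def field_simps)
  obtain C where C: "\<And>k l. norm (rGamma (\<alpha> * of_nat k + \<beta> * of_nat l + \<gamma>)) \<le> C * \<epsilon> ^ (k + l)"
    using rGamma_lattice_bound[OF assms \<epsilon>, of \<gamma>] by blast
  have "C \<ge> 0" using order_trans[OF norm_ge_zero C[of 0 0]] by simp
  have "(\<lambda>n. norm (pochhammer \<delta> n / fact n) * (3 / 4) ^ n) \<longlonglongrightarrow> 0"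
    by (intro summable_LIMSEQ_zero neg_binomial_norm_summable) auto
  then have "Bseq (\<lambda>n. norm (pochhammer \<delta> n / fact n) * (3 / 4) ^ n)"
    by (intro convergent_imp_Bseq) (auto simp: convergent_def)
  then obtain D where "\<forall>n. norm (norm (pochhammer \<delta> n / fact n) * (3 / 4) ^ n) \<le> D"
    by (rule BseqE)
  then have D: "norm (pochhammer \<delta> n / fact n) * (3 / 4) ^ n \<le> D" for n
    using abs_le_D1[of "norm (pochhammer \<delta> n / fact n) * (3 / 4) ^ n" D] unfolding real_norm_def by blast
  have "norm (pochhammer \<delta> (k + l) * rGamma (\<alpha> * of_nat k + \<beta> * of_nat l + \<gamma>)
      * (x ^ k * y ^ l / (fact k * fact l))) \<le> (C * D) * (2 / 3) ^ (k + l)" for k l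
  proof -
    let ?n = "k + l" and ?r = "norm (rGamma (\<alpha> * of_nat k + \<beta> * of_nat l + \<gamma>))"
    have bin: "real (?n choose k) \<le> 2 ^ ?n"
      using binomial_le_pow2[of ?n k] by (metis of_nat_le_iff of_nat_numeral of_nat_power)
    have fct: "1 / (fact k * fact l) = real (?n choose k) / fact ?n"
      by (simp add: binomial_fact)
    have p: "norm x ^ k * norm y ^ l * \<epsilon> ^ ?n \<le> (1 / 4) ^ ?n"
    proof -
      have "norm x ^ k * norm y ^ l * \<epsilon> ^ ?n = (norm x * \<epsilon>) ^ k * (norm y * \<epsilon>) ^ l"
        by (simp add: power_mult_distrib power_add mult_ac)
      also have "\<dots> \<le> (1 / 4) ^ k * (1 / 4) ^ l"
        using xy \<epsilon> by (intro mult_mono power_mono) auto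
      finally show ?thesis by (simp add: power_add)
    qed
    have "norm (pochhammer \<delta> ?n * rGamma (\<alpha> * of_nat k + \<beta> * of_nat l + \<gamma>)
        * (x ^ k * y ^ l / (fact k * fact l)))
        = norm (pochhammer \<delta> ?n) * (1 / (fact k * fact l)) * (norm x ^ k * norm y ^ l) * ?r"
      by (simp add: norm_mult norm_divide norm_power)
    also have "\<dots> = norm (pochhammer \<delta> ?n / fact ?n) * real (?n choose k) * (norm x ^ k * norm y ^ l) * ?r"
      unfolding fct by (simp add: norm_divide)
    also have "\<dots> \<le> norm (pochhammer \<delta> ?n / fact ?n) * 2 ^ ?n * (norm x ^ k * norm y ^ l) * (C * \<epsilon> ^ ?n)"
      using bin C[of k l] by (intro mult_mono) auto
    also have "\<dots> = norm (pochhammer \<delta> ?n / fact ?n) * 2 ^ ?n * C * (norm x ^ k * norm y ^ l * \<epsilon> ^ ?n)"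
      by (simp only: mult_ac)
    also have "\<dots> \<le> norm (pochhammer \<delta> ?n / fact ?n) * 2 ^ ?n * C * (1 / 4) ^ ?n"
      using p \<open>C \<ge> 0\<close> by (intro mult_left_mono) auto
    also have "\<dots> = norm (pochhammer \<delta> ?n / fact ?n) * C * (2 ^ ?n * (1 / 4) ^ ?n)"
      by (simp only: mult_ac)
    also have "2 ^ ?n * (1 / 4) ^ ?n = ((3 / 4) ^ ?n * (2 / 3) ^ ?n :: real)"
      by (simp flip: power_mult_distrib)
    also have "norm (pochhammer \<delta> ?n / fact ?n) * C * ((3 / 4) ^ ?n * (2 / 3) ^ ?n)
        = (norm (pochhammer \<delta> ?n / fact ?n) * (3 / 4) ^ ?n) * (C * (2 / 3) ^ ?n)"
      by (simp only: mult_ac)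
    also have "\<dots> \<le> D * (C * (2 / 3) ^ ?n)"
      using \<open>C \<ge> 0\<close> by (intro mult_right_mono D) auto
    finally show ?thesis by (simp add: mult_ac)
  qed
  then have "\<forall>k l. norm (pochhammer \<delta> (k + l) * rGamma (\<alpha> * of_nat k + \<beta> * of_nat l + \<gamma>)
      * (x ^ k * y ^ l / (fact k * fact l))) \<le> (C * D) * (2 / 3) ^ (k + l)"
    by blast
  then show ?thesis by (rule exI)
qed

section \<open>Termwise integration\<close>

lemma closed_hankel_image:
  assumes "valid_path g"
  shows "closed (hankel_image g)"
proof -
  have "closed (left_ray p)" for p
    unfolding left_ray_def by (intro closed_Collect_conj closed_Collect_le closed_Collect_eq continuous_intros)
  then show ?thesis
    unfolding hankel_image_def using assms
    by (intro closed_Un compact_imp_closed[OF compact_path_image] valid_path_imp_path)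
qed

text \<open>
  Admissibility bounds the norm by 1 pointwise.  Since the expression tends to 0 along the rays, its
  supremum is attained on a compact part of the contour or is at most \<open>1/2\<close>, so a uniform bound below 1 follows.
\<close>

lemma hankel_admissible_uniform:
  assumes "Re \<alpha> > 0" "Re \<beta> > 0" "hankel_contour g" "hankel_admissible \<alpha> \<beta> x y g"
  shows "\<exists>r>0. r < 1 \<and> (\<forall>t \<in> hankel_image g. norm (x * t powr (-\<alpha>) + y * t powr (-\<beta>)) < r)"
proof -
  let ?h = "\<lambda>t. x * t powr (-\<alpha>) + y * t powr (-\<beta>)"
  obtain R1 where R1: "\<And>t. norm t \<ge> R1 \<Longrightarrow> norm (x * t powr (-\<alpha>)) < 1/4"
    using norm_powr_neg_small[OF assms(1), of "1/4" x] by auto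
  obtain R2 where R2: "\<And>t. norm t \<ge> R2 \<Longrightarrow> norm (y * t powr (-\<beta>)) < 1/4"
    using norm_powr_neg_small[OF assms(2), of "1/4" y] by auto
  define R where "R = max R1 R2"
  have far: "norm (?h t) < 1/2" if "norm t \<ge> R" for t
    using norm_triangle_ineq[of "x * t powr (-\<alpha>)" "y * t powr (-\<beta>)"] R1[of t] R2[of t] that
    by (auto simp: R_def)
  define K where "K = hankel_image g \<inter> cball 0 R"
  have "?h holomorphic_on slit_plane" by (auto intro!: holomorphic_intros)
  then have "continuous_on K ?h"
    by (rule continuous_on_subset[OF holomorphic_on_imp_continuous_on])
      (use hankel_image_subset_slit_plane[OF assms(3)] in \<open>auto simp: K_def\<close>)
  moreover have "compact K" unfolding K_def
    using assms(3) by (intro closed_Int_compact closed_hankel_image) (auto simp: hankel_contour_def)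
  ultimately have "compact ((\<lambda>t. norm (?h t)) ` K)"
    by (intro compact_continuous_image continuous_on_norm)
  then have fin: "compact (insert (1/2) ((\<lambda>t. norm (?h t)) ` K))" by simp
  obtain m where m: "m \<in> insert (1/2) ((\<lambda>t. norm (?h t)) ` K)"
      "\<And>w. w \<in> insert (1/2) ((\<lambda>t. norm (?h t)) ` K) \<Longrightarrow> w \<le> m"
    using compact_attains_sup[OF fin] by blast
  have "m < 1" using m(1) assms(4) by (auto simp: hankel_admissible_def K_def)
  moreover have "1/2 \<le> m" using m(2) by blast
  moreover have "norm (?h t) \<le> m" if "t \<in> hankel_image g" for t
  proof (cases "norm t \<le> R")
    case True
    then show ?thesis using m(2) that by (auto simp: K_def)
  next
    case False
    then show ?thesis using far[of t] \<open>1/2 \<le> m\<close> by linarith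
  qed
  ultimately show ?thesis by (intro exI[of _ "(1 + m) / 2"]) force
qed

text \<open>
  Expanding the power gives finitely many pure powers of \<open>t\<close>, to each of which Hankel's formula
  applies.
\<close>

lemma hankel_integral_binomial_power:
  assumes g: "hankel_contour g"
  shows "hankel_integrable (\<lambda>t. exp t * t powr (-\<gamma>) * (x * t powr (-\<alpha>) + y * t powr (-\<beta>)) ^ n) g \<and>
    hankel_integral (\<lambda>t. exp t * t powr (-\<gamma>) * (x * t powr (-\<alpha>) + y * t powr (-\<beta>)) ^ n) g
    = 2 * of_real pi * \<i> * (\<Sum>k\<le>n. of_nat (n choose k) * x ^ k * y ^ (n - k)
        * rGamma (\<alpha> * of_nat k + \<beta> * of_nat (n - k) + \<gamma>))"
proof -
  let ?f = "\<lambda>t. exp t * t powr (-\<gamma>) * (x * t powr (-\<alpha>) + y * t powr (-\<beta>)) ^ n"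
  let ?c = "\<lambda>k. of_nat (n choose k) * x ^ k * y ^ (n - k)"
  let ?s = "\<lambda>k. \<alpha> * of_nat k + \<beta> * of_nat (n - k) + \<gamma>"
  let ?h = "\<lambda>t. \<Sum>k\<le>n. ?c k * (exp t * t powr (- ?s k))"
  have "?f t = ?h t" if "t \<in> hankel_image g" for t
  proof -
    have "t \<noteq> 0" using that hankel_image_subset_slit_plane[OF g] by auto
    have "?f t = (\<Sum>k\<le>n. ?c k * (exp t * t powr (-\<gamma>) * ((t powr (- \<alpha>)) ^ k * (t powr (- \<beta>)) ^ (n - k))))"
      unfolding binomial_ring sum_distrib_left by (intro sum.cong) (simp_all add: power_mult_distrib mult_ac)
    then show ?thesis unfolding kernel_times_powers[OF \<open>t \<noteq> 0\<close>] .
  qed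
  note cong = hankel_integral_cong[of g ?f ?h, OF this]
  note int = hankel_integrable_cmult[OF hankel_integrable_kernel[OF g]]
  have "hankel_integrable ?h g \<and> hankel_integral ?h g
      = (\<Sum>k\<le>n. hankel_integral (\<lambda>t. ?c k * (exp t * t powr (- ?s k))) g)"
    by (intro hankel_integrable_sum int) auto
  also have "(\<Sum>k\<le>n. hankel_integral (\<lambda>t. ?c k * (exp t * t powr (- ?s k))) g)
      = 2 * of_real pi * \<i> * (\<Sum>k\<le>n. ?c k * rGamma (?s k))"
    unfolding int(2) hankel_integral_rGamma[OF g] sum_distrib_left by (intro sum.cong) (simp_all add: mult_ac)
  finally show ?thesis using cong by simp
qed

text \<open>
  On the region where \<open>h\<close> is bounded by some \<open>r < 1\<close> the binomial series of \<open>(1 - h) powr (-\<delta>)\<close>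
  converges uniformly.  The Hankel integral is continuous for uniform convergence of this factor, so the
  series may be integrated term by term.
\<close>

lemma hankel_integral_neg_binomial:
  fixes \<alpha> \<beta> \<gamma> \<delta> x y :: complex
  assumes "Re \<alpha> > 0" "Re \<beta> > 0" and g: "hankel_contour g" and "hankel_admissible \<alpha> \<beta> x y g"
  defines "h \<equiv> \<lambda>t. x * t powr (-\<alpha>) + y * t powr (-\<beta>)"
  shows "hankel_integrable (\<lambda>t. exp t * t powr (-\<gamma>) * (1 - h t) powr (-\<delta>)) g"
    and "(\<lambda>n. pochhammer \<delta> n / fact n * hankel_integral (\<lambda>t. exp t * t powr (-\<gamma>) * h t ^ n) g)
      sums hankel_integral (\<lambda>t. exp t * t powr (-\<gamma>) * (1 - h t) powr (-\<delta>)) g"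
proof -
  obtain r where r: "0 < r" "r < 1" and hr: "\<And>t. t \<in> hankel_image g \<Longrightarrow> norm (h t) < r"
    using hankel_admissible_uniform[OF assms(1-4)] unfolding h_def by auto
  define e where "e = (\<lambda>n. pochhammer \<delta> n / fact n)"
  define V where "V = slit_plane \<inter> h -` ball 0 r"
  define T where "T = (\<lambda>N. \<Sum>n. norm (e (n + N)) * r ^ (n + N))"
  let ?k = "\<lambda>t. exp t * t powr (-\<gamma>)" and ?F = "\<lambda>t. (1 - h t) powr (-\<delta>)"
  let ?q = "\<lambda>N t. ?F t - (\<Sum>n<N. e n * h t ^ n)"
  have hol: "h holomorphic_on slit_plane" unfolding h_def by (auto intro!: holomorphic_intros)
  have "open V" unfolding V_def
    by (intro continuous_open_preimage holomorphic_on_imp_continuous_on hol open_slit_plane open_ball)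
  have Vsub: "V \<subseteq> slit_plane" by (auto simp: V_def)
  have holV: "h holomorphic_on V" using hol Vsub by (rule holomorphic_on_subset)
  have hV: "norm (h t) < r" if "t \<in> V" for t using that by (auto simp: V_def)
  have img: "hankel_image g \<subseteq> V" using hankel_image_subset_slit_plane[OF g] hr by (auto simp: V_def)
  have base: "1 - h t \<notin> \<real>\<^sub>\<le>\<^sub>0" if "t \<in> V" for t
    using hV[OF that] r complex_Re_le_cmod[of "h t"] by (auto simp: complex_nonpos_Reals_iff)
  have summ: "summable (\<lambda>n. norm (e n) * r ^ n)"
    unfolding e_def using r by (intro neg_binomial_norm_summable) auto
  have tail: "norm (?q N t) \<le> T N" if t: "t \<in> V" for N t
  proof -
    have "(\<lambda>n. e n * h t ^ n) sums ?F t"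
      unfolding e_def using hV[OF t] r by (intro neg_binomial_sums) auto
    then have "?q N t = (\<Sum>n. e (n + N) * h t ^ (n + N))"
      using suminf_minus_initial_segment[of "\<lambda>n. e n * h t ^ n" N] by (simp add: sums_iff)
    also have "norm \<dots> \<le> T N"
      unfolding T_def
    proof (rule norm_suminf_le)
      show "norm (e (n + N) * h t ^ (n + N)) \<le> norm (e (n + N)) * r ^ (n + N)" for n
        unfolding norm_mult norm_power
        using hV[OF t] by (intro mult_left_mono power_mono) auto
      show "summable (\<lambda>n. norm (e (n + N)) * r ^ (n + N))"
        using summ by (rule summable_ignore_initial_segment)
    qed
    finally show ?thesis .
  qed
  have T0: "T \<longlonglongrightarrow> 0"
  proof -
    have "T = (\<lambda>N. (\<Sum>n. norm (e n) * r ^ n) - (\<Sum>n<N. norm (e n) * r ^ n))"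
      unfolding T_def using suminf_minus_initial_segment[OF summ] by auto
    moreover have "\<dots> \<longlonglongrightarrow> (\<Sum>n. norm (e n) * r ^ n) - (\<Sum>n. norm (e n) * r ^ n)"
      by (intro tendsto_diff tendsto_const summable_LIMSEQ summ)
    ultimately show ?thesis by simp
  qed
  have qhol: "?q N holomorphic_on V" for N
    using base holV by (auto intro!: holomorphic_intros)
  have hint: "hankel_integrable (\<lambda>t. ?k t * h t ^ n) g" for n
    using hankel_integral_binomial_power[OF g] unfolding h_def by blast
  obtain L where L: "\<And>N. hankel_integrable (\<lambda>t. ?k t * ?q N t) g \<and>
      norm (hankel_integral (\<lambda>t. ?k t * ?q N t) g) \<le> L * T N"
  proof (rule hankel_integral_bound[OF g \<open>open V\<close> Vsub img, where s = "- \<gamma>"])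
    fix L
    assume "\<And>q B. q holomorphic_on V \<Longrightarrow> (\<And>t. t \<in> V \<Longrightarrow> norm (q t) \<le> B) \<Longrightarrow>
      hankel_integrable (\<lambda>t. ?k t * q t) g \<and> norm (hankel_integral (\<lambda>t. ?k t * q t) g) \<le> L * B"
    from that[OF this[OF qhol tail]] show ?thesis .
  qed
  show F: "hankel_integrable (\<lambda>t. ?k t * ?F t) g"
    using L[of 0] by simp
  let ?I = "hankel_integral (\<lambda>t. ?k t * ?F t) g"
  have "?I - (\<Sum>n<N. e n * hankel_integral (\<lambda>t. ?k t * h t ^ n) g) = hankel_integral (\<lambda>t. ?k t * ?q N t) g" for N
  proof -
    let ?S = "\<lambda>t. \<Sum>n<N. e n * (?k t * h t ^ n)"
    have S: "hankel_integrable ?S g \<and> hankel_integral ?S g = (\<Sum>n<N. hankel_integral (\<lambda>t. e n * (?k t * h t ^ n)) g)"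
      by (intro hankel_integrable_sum hankel_integrable_cmult hint) auto
    have "(\<lambda>t. ?k t * ?q N t) = (\<lambda>t. ?k t * ?F t + (-1) * ?S t)"
      by (auto simp: fun_eq_iff algebra_simps sum_distrib_left sum_negf)
    then have "hankel_integral (\<lambda>t. ?k t * ?q N t) g = ?I + (-1) * hankel_integral ?S g"
      using hankel_integrable_add(2)[OF F hankel_integrable_cmult(1)[of ?S g "-1"]]
        hankel_integrable_cmult(2)[of ?S g "-1"] S by presburger
    then show ?thesis using S hankel_integrable_cmult(2)[OF hint] by simp
  qed
  then have bd: "norm (?I - (\<Sum>n<N. e n * hankel_integral (\<lambda>t. ?k t * h t ^ n) g)) \<le> L * T N" for N
    using L by simp
  have "(\<lambda>N. ?I - (\<Sum>n<N. e n * hankel_integral (\<lambda>t. ?k t * h t ^ n) g)) \<longlonglongrightarrow> 0"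
    by (rule Lim_null_comparison[OF always_eventually[OF allI[OF bd]]])
      (use tendsto_mult[OF tendsto_const[of L] T0] in simp)
  from tendsto_diff[OF tendsto_const[of ?I] this]
  show "(\<lambda>n. pochhammer \<delta> n / fact n * hankel_integral (\<lambda>t. ?k t * h t ^ n) g) sums ?I"
    unfolding sums_def e_def by simp
qed

section \<open>The integral representation\<close>

theorem theorem2p6:
  fixes \<alpha> \<beta> \<gamma> \<delta> x y :: complex and H :: "real \<Rightarrow> complex"
  assumes "Re \<alpha> > 0" and "Re \<beta> > 0"
    and "hankel_contour H"
    and "hankel_admissible \<alpha> \<beta> x y H"
  shows "hankel_integrable
           (\<lambda>t. exp t * t powr (-\<gamma>) / (1 - x * t powr (-\<alpha>) - y * t powr (-\<beta>)) powr \<delta>) H \<and>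
         bivariate_mittag_leffler \<alpha> \<beta> \<gamma> \<delta> x y =
           1 / (2 * of_real pi * \<i>) * hankel_integral
           (\<lambda>t. exp t * t powr (-\<gamma>) / (1 - x * t powr (-\<alpha>) - y * t powr (-\<beta>)) powr \<delta>) H"
proof -
  let ?h = "\<lambda>t. x * t powr (-\<alpha>) + y * t powr (-\<beta>)"
  let ?F = "\<lambda>t. exp t * t powr (-\<gamma>) / (1 - x * t powr (-\<alpha>) - y * t powr (-\<beta>)) powr \<delta>"
  define a where "a = (\<lambda>k l. pochhammer \<delta> (k + l) * rGamma (\<alpha> * of_nat k + \<beta> * of_nat l + \<gamma>)
               * (x ^ k * y ^ l / (fact k * fact l)))"
  have F: "?F = (\<lambda>t. exp t * t powr (-\<gamma>) * (1 - ?h t) powr (-\<delta>))"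
    by (simp add: fun_eq_iff powr_minus divide_inverse diff_diff_eq)
  note int = hankel_integral_neg_binomial[OF assms, where \<gamma> = \<gamma> and \<delta> = \<delta>, folded F]
  \<comment> \<open>The terms of degree \<open>n\<close> in \<open>h\<close> produce the n-th diagonal of the double series.\<close>
  have "pochhammer \<delta> n / fact n * hankel_integral (\<lambda>t. exp t * t powr (-\<gamma>) * ?h t ^ n) H
      = 2 * of_real pi * \<i> * (\<Sum>k\<le>n. a k (n - k))" for n
  proof -
    have "pochhammer \<delta> n / fact n * (of_nat (n choose k) * x ^ k * y ^ (n - k)
        * rGamma (\<alpha> * of_nat k + \<beta> * of_nat (n - k) + \<gamma>)) = a k (n - k)" if "k \<le> n" for k
      using that by (simp add: a_def binomial_fact field_simps)
    then have "(\<Sum>k\<le>n. pochhammer \<delta> n / fact n * (of_nat (n choose k) * x ^ k * y ^ (n - k)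
        * rGamma (\<alpha> * of_nat k + \<beta> * of_nat (n - k) + \<gamma>))) = (\<Sum>k\<le>n. a k (n - k))"
      by (intro sum.cong) auto
    then have "pochhammer \<delta> n / fact n * (\<Sum>k\<le>n. of_nat (n choose k) * x ^ k * y ^ (n - k)
        * rGamma (\<alpha> * of_nat k + \<beta> * of_nat (n - k) + \<gamma>)) = (\<Sum>k\<le>n. a k (n - k))"
      by (simp only: sum_distrib_left)
    then show ?thesis
      unfolding conjunct2[OF hankel_integral_binomial_power[OF assms(3)]]
      by (subst mult.left_commute) (simp only:)
  qed
  note terms = this
  from int(2)[unfolded terms] have "(\<lambda>n. 2 * of_real pi * \<i> * (\<Sum>k\<le>n. a k (n - k))) sums hankel_integral ?F H" .
  moreover have "(\<lambda>n. \<Sum>k\<le>n. a k (n - k)) sums (\<Sum>k. \<Sum>l. a k l)"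
  proof -
    obtain C where "\<forall>k l. norm (a k l) \<le> C * (2 / 3) ^ (k + l)"
      using mittag_leffler_term_bound[OF assms(1,2), of \<delta> \<gamma> x y] unfolding a_def by auto
    then show ?thesis
      by (intro double_series_diagonal_sums[of "2 / 3" a C]) auto
  qed
  then have "(\<lambda>n. 2 * of_real pi * \<i> * (\<Sum>k\<le>n. a k (n - k))) sums
      (2 * of_real pi * \<i> * bivariate_mittag_leffler \<alpha> \<beta> \<gamma> \<delta> x y)"
    unfolding bivariate_mittag_leffler_def a_def by (rule sums_mult)
  ultimately have "hankel_integral ?F H = 2 * of_real pi * \<i> * bivariate_mittag_leffler \<alpha> \<beta> \<gamma> \<delta> x y"
    by (rule sums_unique2)
  then show ?thesis using int(1) by simp
qed

end
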